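(* Let $W(D_4)$ be the group of real $4\times 4$ matrices of the form $D\cdot P(\pi)$, where $D=\mathrm{diag}(\varepsilon_1,\varepsilon_2,\varepsilon_3,\varepsilon_4)$ with $\varepsilon_i\in\{\pm1\}$ and $\varepsilon_1\varepsilon_2\varepsilon_3\varepsilon_4=1$, and $P(\pi)$ is the permutation matrix of $\pi\in\mathfrak S_4$. Then $$\mathrm{Aut}\big(W(D_4)\big)/\mathrm{Int}\big(W(D_4)\big)\simeq \mathfrak S_3\times \mathbb Z/2\mathbb Z,$$ where $\mathrm{Int}(W(D_4))$ is the group of inner automorphisms.
   Context: $W(D_4)\cong\mathfrak S_2^3\rtimes\mathfrak S_4$ is the Weyl group of type $D_4$. The $\mathbb Z/2\mathbb Z$ factor is generated by the class of the automorphism $\psi\colon x\mapsto x\cdot\det(x)$ (i.e. $D\cdot P(\pi)\mapsto D\cdot P(\pi)\cdot(-1)^{\mathrm{sgn}(\pi)}$ as a scalar sign). *)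

theory Defs
  imports "HOL-Analysis.Analysis" "HOL-Algebra.Algebra"
begin

text \<open>Permutation matrix of a permutation of the index type 4.\<close>
definition perm_mat :: "(4 \<Rightarrow> 4) \<Rightarrow> real^4^4" where
  "perm_mat \<pi> = (\<chi> i j. if i = \<pi> j then 1 else 0)"

text \<open>Diagonal matrix with diagonal entries e.\<close>
definition diag_mat :: "(4 \<Rightarrow> real) \<Rightarrow> real^4^4" where
  "diag_mat e = (\<chi> i j. if i = j then e i else 0)"

text \<open>The Weyl group W(D4): matrices D * P(pi), D = diag(eps) with eps_i = +-1,
  product of the eps_i equal to 1, pi in S4.\<close>
definition W_D4 :: "(real^4^4) monoid" where
  "W_D4 = \<lparr> carrier = {diag_mat e ** perm_mat \<pi> | e \<pi>.
                         (\<forall>i. e i \<in> {1, -1}) \<and> (\<Prod>i\<in>UNIV. e i) = 1 \<and> \<pi> permutes (UNIV :: 4 set)},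
           mult = (**),
           one = mat 1 \<rparr>"

text \<open>Inner automorphisms of a group (as extensional functions, matching AutoGroup).\<close>
definition Inn :: "('a, 'b) monoid_scheme \<Rightarrow> ('a \<Rightarrow> 'a) set" where
  "Inn G = {(\<lambda>x \<in> carrier G. g \<otimes>\<^bsub>G\<^esub> x \<otimes>\<^bsub>G\<^esub> inv\<^bsub>G\<^esub> g) | g. g \<in> carrier G}"

end

theory Submission
  imports Defs "HOL-Combinatorics.Transposition"
begin

text \<open>
  W(D4) has 192 elements, all of which are listed as signed permutations, so that statements about
  finitely many elements can be checked by evaluation. Its non-central involutions form five conjugacy
  classes: three of size 6 and two of size 12, the latter two interchanged by multiplication with
  the central element \<open>-1\<close>. An automorphism fixes \<open>-1\<close>, hence permutes the three small classes
  and fixes or swaps the two large ones; this gives a homomorphism from Aut(W(D4)) onto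
  S3 \<times> Z/2. Its kernel consists of the class-preserving automorphisms, which are inner because
  they can be normalised to fix the Coxeter generators. Conjugation by two reflections normalising
  W(D4) realises the transpositions of S3, and \<open>x \<mapsto> det x \<cdot> x\<close> realises Z/2.
\<close>

section \<open>Conjugacy and automorphisms\<close>

definition conjugate :: "('a, 'b) monoid_scheme \<Rightarrow> 'a \<Rightarrow> 'a \<Rightarrow> bool" where
  "conjugate G x y \<longleftrightarrow> (\<exists>g\<in>carrier G. g \<otimes>\<^bsub>G\<^esub> x \<otimes>\<^bsub>G\<^esub> inv\<^bsub>G\<^esub> g = y)"

context group
begin

lemma conjugate_sym:
  assumes "conjugate G x y" "x \<in> carrier G"
  shows "conjugate G y x"
proof -
  obtain g where g: "g \<in> carrier G" "g \<otimes> x \<otimes> inv g = y"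
    using assms(1) by (auto simp: conjugate_def)
  then have "inv g \<otimes> y \<otimes> inv (inv g) = x"
    using conjugation_is_surj[of "inv g" x] assms(2) by simp
  then show ?thesis unfolding conjugate_def using inv_closed[OF g(1)] by blast
qed

lemma conjugate_trans:
  assumes "conjugate G x y" "conjugate G y z" "x \<in> carrier G"
  shows "conjugate G x z"
proof -
  obtain g h where g: "g \<in> carrier G" "g \<otimes> x \<otimes> inv g = y"
    and h: "h \<in> carrier G" "h \<otimes> y \<otimes> inv h = z"
    using assms(1,2) by (auto simp: conjugate_def)
  have "(h \<otimes> g) \<otimes> x \<otimes> inv (h \<otimes> g) = h \<otimes> (g \<otimes> x \<otimes> inv g) \<otimes> inv h"
    using g(1) h(1) assms(3) by (simp add: m_assoc inv_mult_group)
  then have "(h \<otimes> g) \<otimes> x \<otimes> inv (h \<otimes> g) = z"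
    using g(2) h(2) by simp
  then show ?thesis using g(1) h(1) by (auto simp: conjugate_def)
qed

lemma conjugate_if_commute:
  assumes "g \<in> carrier G" "x \<in> carrier G" "y \<in> carrier G" "g \<otimes> x = y \<otimes> g"
  shows "g \<otimes> x \<otimes> inv g = y"
  using assms by (simp add: m_assoc)

lemma inner_in_auto:
  assumes "g \<in> carrier G"
  shows "(\<lambda>x\<in>carrier G. g \<otimes> x \<otimes> inv g) \<in> auto G"
proof -
  have "inv g \<otimes> (g \<otimes> y) = y" if "y \<in> carrier G" for y
    using assms that by (simp add: m_assoc[symmetric])
  then have "(\<lambda>x\<in>carrier G. g \<otimes> x \<otimes> inv g) \<in> hom G G"
    using assms by (auto intro!: homI simp: m_assoc)
  then show ?thesis
    using conjugation_is_bij[OF assms] by (simp add: auto_def Bij_def)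
qed

lemma auto_group_hom: "a \<in> auto G \<Longrightarrow> group_hom G G a"
  by (simp add: auto_def group_hom_def group_hom_axioms_def is_group)

lemma auto_inj_on: "a \<in> auto G \<Longrightarrow> inj_on a (carrier G)"
  by (simp add: auto_def Bij_def bij_betw_def)

lemma auto_conjugate:
  assumes a: "a \<in> auto G" and xy: "conjugate G x y" and x: "x \<in> carrier G"
  shows "conjugate G (a x) (a y)"
proof -
  interpret a: group_hom G G a using auto_group_hom[OF a] .
  obtain g where g: "g \<in> carrier G" "g \<otimes> x \<otimes> inv g = y"
    using xy by (auto simp: conjugate_def)
  have "a g \<otimes> a x \<otimes> inv (a g) = a y"
    unfolding g(2)[symmetric] using g(1) x by (simp add: a.hom_mult a.hom_inv)
  then show ?thesis
    unfolding conjugate_def using a.hom_closed[OF g(1)] by blast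
qed

lemma auto_inverse:
  assumes a: "a \<in> auto G"
  shows "\<exists>b\<in>auto G. \<forall>x\<in>carrier G. b (a x) = x"
proof -
  have "inj_on a (carrier G)" "a ` carrier G = carrier G"
    using a by (auto simp: auto_def Bij_def bij_betw_def)
  then have "\<forall>x\<in>carrier G. restrict (inv_into (carrier G) a) (carrier G) (a x) = x"
    by auto
  moreover have "restrict (inv_into (carrier G) a) (carrier G) \<in> auto G"
    using a by (simp add: auto_def restrict_inv_into_hom restrict_inv_into_Bij)
  ultimately show ?thesis by blast
qed

lemma inner_comp_auto:
  assumes a: "a \<in> auto G" and g: "g \<in> carrier G"
  shows "(\<lambda>x\<in>carrier G. g \<otimes> a x \<otimes> inv g) \<in> auto G"
proof -
  let ?c = "\<lambda>x\<in>carrier G. g \<otimes> x \<otimes> inv g"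
  have "compose (carrier G) ?c a \<in> auto G"
    using inner_in_auto[OF g] a by (auto simp: auto_def intro: hom_compose compose_Bij)
  moreover have "compose (carrier G) ?c a = (\<lambda>x\<in>carrier G. g \<otimes> a x \<otimes> inv g)"
    using a by (fastforce simp: compose_def auto_def hom_def)
  ultimately show ?thesis by simp
qed

lemma auto_central:
  assumes a: "a \<in> auto G" and z: "z \<in> carrier G" and central: "\<forall>y\<in>carrier G. z \<otimes> y = y \<otimes> z"
    and y: "y \<in> carrier G"
  shows "a z \<otimes> y = y \<otimes> a z"
proof -
  interpret a: group_hom G G a using auto_group_hom[OF a] .
  obtain y' where y': "y' \<in> carrier G" "y = a y'"
    using a y by (auto simp: auto_def Bij_def bij_betw_def)
  have "a z \<otimes> a y' = a (z \<otimes> y')" using z y'(1) by (simp add: a.hom_mult)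
  also have "\<dots> = a (y' \<otimes> z)" using central y'(1) by simp
  also have "\<dots> = a y' \<otimes> a z" using z y'(1) by (simp add: a.hom_mult)
  finally show ?thesis using y'(2) by simp
qed

lemma Inn_if_inner_comp:
  assumes a: "a \<in> auto G" and g: "g \<in> carrier G" and inner: "(\<lambda>x\<in>carrier G. g \<otimes> a x \<otimes> inv g) \<in> Inn G"
  shows "a \<in> Inn G"
proof -
  obtain h where h: "h \<in> carrier G"
    and eq: "(\<lambda>x\<in>carrier G. g \<otimes> a x \<otimes> inv g) = (\<lambda>x\<in>carrier G. h \<otimes> x \<otimes> inv h)"
    using inner by (auto simp: Inn_def)
  have "a x = (inv g \<otimes> h) \<otimes> x \<otimes> inv (inv g \<otimes> h)" if x: "x \<in> carrier G" for x
  proof -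
    have "a x \<in> carrier G" using a x by (auto simp: auto_def hom_def)
    moreover have "g \<otimes> a x \<otimes> inv g = h \<otimes> x \<otimes> inv h" using fun_cong[OF eq, of x] x by simp
    ultimately have "a x = inv g \<otimes> (h \<otimes> x \<otimes> inv h) \<otimes> inv (inv g)"
      using conjugation_is_surj[of "inv g" "a x"] g by simp
    then show ?thesis using g h x by (simp add: m_assoc inv_mult_group)
  qed
  moreover have "a \<in> extensional (carrier G)" using a by (simp add: auto_def Bij_def)
  ultimately have "a = (\<lambda>x\<in>carrier G. (inv g \<otimes> h) \<otimes> x \<otimes> inv (inv g \<otimes> h))"
    by (auto simp: extensional_def)
  then show ?thesis using g h by (auto simp: Inn_def)
qed

end

section \<open>The group W(D4)\<close>

definition signed_perm_mat :: "(4 \<Rightarrow> real) \<Rightarrow> (4 \<Rightarrow> 4) \<Rightarrow> real^4^4" where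
  "signed_perm_mat e p = diag_mat e ** perm_mat p"

definition even_signs_perm :: "(4 \<Rightarrow> real) \<Rightarrow> (4 \<Rightarrow> 4) \<Rightarrow> bool" where
  "even_signs_perm e p \<longleftrightarrow>
     (\<forall>i. e i \<in> {1, -1}) \<and> (\<Prod>i\<in>UNIV. e i) = 1 \<and> p permutes (UNIV :: 4 set)"

lemma carrier_W_D4: "carrier W_D4 = {signed_perm_mat e p | e p. even_signs_perm e p}"
  by (auto simp: W_D4_def signed_perm_mat_def even_signs_perm_def)

lemma mult_W_D4 [simp]: "mult W_D4 = (**)"
  and one_W_D4 [simp]: "one W_D4 = mat 1"
  by (simp_all add: W_D4_def)

lemma signed_perm_mat_entry: "signed_perm_mat e p $ i $ j = (if i = p j then e i else 0)"
proof -
  have "signed_perm_mat e p $ i $ j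
      = (\<Sum>k\<in>UNIV. (if i = k then e i else 0) * (if k = p j then 1 else 0))"
    by (simp add: signed_perm_mat_def matrix_matrix_mult_def diag_mat_def perm_mat_def)
  also have "\<dots> = (\<Sum>k\<in>UNIV. if k = i then (if i = p j then e i else 0) else 0)"
    by (rule sum.cong) auto
  finally show ?thesis by simp
qed

lemma signed_perm_mat_mult:
  assumes p: "p permutes (UNIV :: 4 set)"
  shows "signed_perm_mat e p ** signed_perm_mat f q
       = signed_perm_mat (\<lambda>i. e i * f (inv' p i)) (p \<circ> q)"
proof -
  have "(signed_perm_mat e p ** signed_perm_mat f q) $ i $ j
      = signed_perm_mat (\<lambda>i. e i * f (inv' p i)) (p \<circ> q) $ i $ j" for i j
  proof -
    have "(signed_perm_mat e p ** signed_perm_mat f q) $ i $ j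
        = (\<Sum>k\<in>UNIV. (if i = p k then e i else 0) * (if k = q j then f k else 0))"
      by (simp add: matrix_matrix_mult_def signed_perm_mat_entry)
    also have "\<dots> = (\<Sum>k\<in>UNIV. if k = q j then (if i = p k then e i else 0) * f k else 0)"
      by (rule sum.cong) auto
    also have "\<dots> = (if i = p (q j) then e i * f (q j) else 0)" by simp
    finally show ?thesis
      by (auto simp: signed_perm_mat_entry permutes_inverses[OF p])
  qed
  then show ?thesis by (simp add: vec_eq_iff)
qed

lemma even_signs_perm_mult:
  assumes "even_signs_perm e p" "even_signs_perm f q"
  shows "even_signs_perm (\<lambda>i. e i * f (inv' p i)) (p \<circ> q)"
proof -
  have p: "p permutes UNIV" using assms by (simp add: even_signs_perm_def)
  have "(\<Prod>i\<in>UNIV. f (inv' p i)) = (\<Prod>i\<in>UNIV. f i)"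
    using prod.permute[OF permutes_inv[OF p], of f] by (simp add: o_def)
  then have "(\<Prod>i\<in>UNIV. e i * f (inv' p i)) = 1"
    using assms by (simp add: prod.distrib even_signs_perm_def)
  moreover have "e i * f (inv' p i) \<in> {1, -1}" for i
  proof -
    have "e i = 1 \<or> e i = -1" "f (inv' p i) = 1 \<or> f (inv' p i) = -1"
      using assms by (auto simp: even_signs_perm_def)
    then show ?thesis by auto
  qed
  ultimately show ?thesis using assms by (auto simp: even_signs_perm_def permutes_compose)
qed

lemma signed_perm_mat_id: "signed_perm_mat (\<lambda>_. 1) id = mat 1"
  by (simp add: vec_eq_iff signed_perm_mat_entry mat_def)

lemma signed_perm_mat_left_inverse:
  assumes "even_signs_perm e p"
  shows "signed_perm_mat (\<lambda>i. e (p i)) (inv' p) ** signed_perm_mat e p = mat 1"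
    and "even_signs_perm (\<lambda>i. e (p i)) (inv' p)"
proof -
  have p: "p permutes UNIV" using assms by (simp add: even_signs_perm_def)
  have "e i * e i = 1" for i
  proof -
    have "e i = 1 \<or> e i = -1" using assms by (simp add: even_signs_perm_def)
    then show ?thesis by auto
  qed
  then show "signed_perm_mat (\<lambda>i. e (p i)) (inv' p) ** signed_perm_mat e p = mat 1"
    by (simp add: signed_perm_mat_mult permutes_inv[OF p] permutes_inv_inv[OF p]
        permutes_inv_o(2)[OF p] signed_perm_mat_id)
  have "(\<Prod>i\<in>UNIV. e (p i)) = (\<Prod>i\<in>UNIV. e i)"
    using prod.permute[OF p, of e] by (simp add: o_def)
  then show "even_signs_perm (\<lambda>i. e (p i)) (inv' p)"
    using assms permutes_inv[OF p] by (auto simp: even_signs_perm_def)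
qed

lemma group_W_D4: "group W_D4"
proof (rule groupI)
  fix x y assume "x \<in> carrier W_D4" "y \<in> carrier W_D4"
  then obtain e p f q where x: "x = signed_perm_mat e p" and ep: "even_signs_perm e p"
    and y: "y = signed_perm_mat f q" and fq: "even_signs_perm f q"
    by (auto simp: carrier_W_D4)
  have p: "p permutes UNIV" using ep by (simp add: even_signs_perm_def)
  show "x \<otimes>\<^bsub>W_D4\<^esub> y \<in> carrier W_D4"
    unfolding carrier_W_D4 mult_W_D4 x y signed_perm_mat_mult[OF p]
    using even_signs_perm_mult[OF ep fq] by blast
next
  have "even_signs_perm (\<lambda>_. 1) id" by (simp add: even_signs_perm_def)
  then show "\<one>\<^bsub>W_D4\<^esub> \<in> carrier W_D4"
    unfolding carrier_W_D4 one_W_D4 using signed_perm_mat_id[symmetric] by blast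
next
  fix x assume "x \<in> carrier W_D4"
  then obtain e p where "x = signed_perm_mat e p" "even_signs_perm e p"
    by (auto simp: carrier_W_D4)
  then show "\<exists>y\<in>carrier W_D4. y \<otimes>\<^bsub>W_D4\<^esub> x = \<one>\<^bsub>W_D4\<^esub>"
    unfolding carrier_W_D4 mult_W_D4 one_W_D4 using signed_perm_mat_left_inverse by blast
qed (simp_all add: matrix_mul_assoc)

interpretation W: group W_D4 by (rule group_W_D4)

lemma W_D4_mult_closed: "x \<in> carrier W_D4 \<Longrightarrow> y \<in> carrier W_D4 \<Longrightarrow> x ** y \<in> carrier W_D4"
  using W.m_closed by simp

section \<open>Signed permutation codes\<close>

type_synonym code = "int list \<times> nat list"

definition index4 :: "4 \<Rightarrow> nat" where
  "index4 i = (if i = 1 then 0 else if i = 2 then 1 else if i = 3 then 2 else 3)"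

definition elem4 :: "nat \<Rightarrow> 4" where
  "elem4 k = (if k = 0 then 1 else if k = 1 then 2 else if k = 2 then 3 else 4)"

lemma less_4_cases: "(k::nat) < 4 \<Longrightarrow> k = 0 \<or> k = 1 \<or> k = 2 \<or> k = 3"
  by auto

lemma index4_less [simp]: "index4 i < 4"
  by (simp add: index4_def)

lemma elem4_index4 [simp]: "elem4 (index4 i) = i"
  using exhaust_4[of i] by (auto simp: index4_def elem4_def)

lemma index4_elem4 [simp]: "k < 4 \<Longrightarrow> index4 (elem4 k) = k"
  using less_4_cases[of k] by (auto simp: index4_def elem4_def)

lemma index4_eq_iff [simp]: "index4 i = index4 j \<longleftrightarrow> i = j"
  by (metis elem4_index4)

text \<open>A code \<open>(s, p)\<close> of lists of length 4 stands for the matrix whose column \<open>j\<close> has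
  the single non-zero entry \<open>s ! j\<close> in row \<open>p ! j\<close> (rows and columns counted from 0).\<close>

definition code_mat :: "code \<Rightarrow> real^4^4" where
  "code_mat v = (\<chi> i j. if index4 i = snd v ! index4 j then real_of_int (fst v ! index4 j) else 0)"

definition code_mult :: "code \<Rightarrow> code \<Rightarrow> code" where
  "code_mult v w = (map (\<lambda>c. fst w ! c * fst v ! (snd w ! c)) [0..<4],
                    map (\<lambda>c. snd v ! (snd w ! c)) [0..<4])"

definition code_wf :: "code \<Rightarrow> bool" where
  "code_wf v \<longleftrightarrow> length (fst v) = 4 \<and> length (snd v) = 4 \<and> (\<forall>k\<in>set (snd v). k < 4)
     \<and> (\<forall>a\<in>set (fst v). a = 1 \<or> a = -1)"

lemma code_mat_entry:
  "code_mat v $ i $ j = (if index4 i = snd v ! index4 j then real_of_int (fst v ! index4 j) else 0)"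
  by (simp add: code_mat_def)

lemma code_wf_snd: "code_wf v \<Longrightarrow> c < 4 \<Longrightarrow> snd v ! c < 4"
  and code_wf_fst: "code_wf v \<Longrightarrow> c < 4 \<Longrightarrow> fst v ! c = 1 \<or> fst v ! c = -1"
  by (auto simp: code_wf_def)

lemma code_mat_mult:
  assumes v: "code_wf v" and w: "code_wf w"
  shows "code_mat v ** code_mat w = code_mat (code_mult v w)"
proof -
  have "(code_mat v ** code_mat w) $ i $ j = code_mat (code_mult v w) $ i $ j" for i j
  proof -
    define c where "c = index4 j"
    define k where "k = snd w ! c"
    have c4: "c < 4" by (simp add: c_def)
    have k4: "k < 4" using code_wf_snd[OF w c4] by (simp add: k_def)
    have "(code_mat v ** code_mat w) $ i $ j = (\<Sum>l\<in>UNIV. code_mat v $ i $ l * code_mat w $ l $ j)"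
      by (simp add: matrix_matrix_mult_def)
    also have "\<dots> = (\<Sum>l\<in>UNIV. code_mat v $ i $ l * (if l = elem4 k then real_of_int (fst w ! c) else 0))"
    proof (rule sum.cong[OF refl])
      fix l
      have "index4 l = k \<longleftrightarrow> l = elem4 k" using k4 by (metis elem4_index4 index4_elem4)
      then show "code_mat v $ i $ l * code_mat w $ l $ j
          = code_mat v $ i $ l * (if l = elem4 k then real_of_int (fst w ! c) else 0)"
        by (simp add: code_mat_entry c_def k_def)
    qed
    also have "\<dots> = code_mat v $ i $ elem4 k * real_of_int (fst w ! c)"
      by (simp add: if_distrib cong: if_cong)
    also have "\<dots> = code_mat (code_mult v w) $ i $ j"
      using k4 c4 by (simp add: code_mat_entry code_mult_def c_def[symmetric] k_def[symmetric] mult.commute)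
    finally show ?thesis .
  qed
  then show ?thesis by (simp add: vec_eq_iff)
qed

lemma code_mat_inj:
  assumes v: "code_wf v" and w: "code_wf w" and eq: "code_mat v = code_mat w"
  shows "v = w"
proof -
  have same: "snd v ! c = snd w ! c \<and> fst v ! c = fst w ! c" if c: "c < 4" for c
  proof -
    have entry: "code_mat v $ elem4 (snd v ! c) $ elem4 c = code_mat w $ elem4 (snd v ! c) $ elem4 c"
      using eq by simp
    have "fst v ! c \<noteq> 0" using code_wf_fst[OF v c] by auto
    then have "snd v ! c = snd w ! c"
      using entry code_wf_snd[OF v c] c by (auto simp: code_mat_entry split: if_splits)
    with entry show ?thesis using code_wf_snd[OF v c] c by (simp add: code_mat_entry)
  qed
  have "length (fst v) = 4" "length (fst w) = 4" "length (snd v) = 4" "length (snd w) = 4"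
    using v w by (auto simp: code_wf_def)
  then have "fst v = fst w \<and> snd v = snd w"
    using same by (auto intro: nth_equalityI)
  then show ?thesis by (simp add: prod_eq_iff)
qed

lemma code_mult_wf:
  assumes v: "code_wf v" and w: "code_wf w"
  shows "code_wf (code_mult v w)"
proof -
  have "fst w ! c * fst v ! (snd w ! c) = 1 \<or> fst w ! c * fst v ! (snd w ! c) = -1" if "c < 4" for c
    using code_wf_fst[OF w that] code_wf_fst[OF v code_wf_snd[OF w that]] by auto
  then show ?thesis
    using code_wf_snd[OF v] code_wf_snd[OF w] by (auto simp: code_wf_def code_mult_def)
qed

definition even_sign_lists :: "int list list" where
  "even_sign_lists = filter (\<lambda>s. prod_list s = 1) (List.n_lists 4 [1, -1])"

definition perm_lists :: "nat list list" where
  "perm_lists = filter distinct (List.n_lists 4 [0, 1, 2, 3])"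

definition W_codes :: "code list" where
  "W_codes = concat (map (\<lambda>p. map (\<lambda>s. (s, p)) even_sign_lists) perm_lists)"

lemma mem_W_codes: "(s, p) \<in> set W_codes \<longleftrightarrow> s \<in> set even_sign_lists \<and> p \<in> set perm_lists"
  by (auto simp: W_codes_def)

lemma mem_even_sign_lists:
  "s \<in> set even_sign_lists \<longleftrightarrow> length s = 4 \<and> set s \<subseteq> {1, -1} \<and> prod_list s = 1"
  by (simp add: even_sign_lists_def set_n_lists)

lemma mem_perm_lists:
  "p \<in> set perm_lists \<longleftrightarrow> length p = 4 \<and> set p \<subseteq> {0, 1, 2, 3} \<and> distinct p"
  by (auto simp: perm_lists_def set_n_lists)

lemma W_codes_wf:
  assumes "v \<in> set W_codes"
  shows "code_wf v"
proof -
  obtain s p where v: "v = (s, p)" by (cases v)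
  then have "length s = 4" "set s \<subseteq> {1, -1}" "length p = 4" "set p \<subseteq> {0, 1, 2, 3}"
    using assms by (simp_all add: mem_W_codes mem_even_sign_lists mem_perm_lists)
  then show ?thesis by (auto simp: code_wf_def v)
qed

lemma code_mat_eq_iff: "v \<in> set W_codes \<Longrightarrow> w \<in> set W_codes \<Longrightarrow> code_mat v = code_mat w \<longleftrightarrow> v = w"
  using code_mat_inj W_codes_wf by blast

definition code_perm :: "nat list \<Rightarrow> 4 \<Rightarrow> 4" where
  "code_perm p j = elem4 (p ! index4 j)"

lemma code_perm_permutes:
  assumes "p \<in> set perm_lists"
  shows "code_perm p permutes UNIV"
    and "index4 i = p ! index4 j \<longleftrightarrow> i = code_perm p j"
proof -
  have p_len: "length p = 4" and p_dist: "distinct p" and p_less: "\<And>k. k \<in> set p \<Longrightarrow> k < 4"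
    using assms by (auto simp: mem_perm_lists)
  have p_nth: "p ! index4 j < 4" for j using p_less p_len by simp
  have "inj (code_perm p)"
  proof (rule injI)
    fix j j' assume "code_perm p j = code_perm p j'"
    then have "index4 (code_perm p j) = index4 (code_perm p j')" by simp
    then have "p ! index4 j = p ! index4 j'" using p_nth by (simp add: code_perm_def)
    then show "j = j'" using p_dist p_len by (simp add: nth_eq_iff_index_eq)
  qed
  then have "bij (code_perm p)" by (simp add: bij_def finite_UNIV_inj_surj)
  then show "code_perm p permutes UNIV" by (auto intro: bij_imp_permutes)
  show "index4 i = p ! index4 j \<longleftrightarrow> i = code_perm p j"
  proof
    assume "index4 i = p ! index4 j"
    then have "elem4 (index4 i) = code_perm p j" by (simp add: code_perm_def)
    then show "i = code_perm p j" by simp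
  qed (use p_nth[of j] in \<open>simp add: code_perm_def\<close>)
qed

lemma prod_index4:
  assumes "length s = 4"
  shows "(\<Prod>j\<in>UNIV. real_of_int (s ! index4 j)) = real_of_int (prod_list s)"
proof -
  have "s = [s ! 0, s ! 1, s ! 2, s ! 3]"
    using assms by (intro nth_equalityI) (auto dest!: less_4_cases)
  then have "prod_list s = s ! 0 * s ! 1 * s ! 2 * s ! 3"
    by (metis mult.assoc prod_list.Cons prod_list.Nil mult_1_right)
  then show ?thesis unfolding UNIV_4 by (simp add: index4_def)
qed

lemma code_mat_in_carrier:
  assumes "v \<in> set W_codes"
  shows "code_mat v \<in> carrier W_D4"
proof -
  obtain s p where v: "v = (s, p)" by (cases v)
  then have s: "s \<in> set even_sign_lists" and p: "p \<in> set perm_lists"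
    using assms by (auto simp: mem_W_codes)
  have s_len: "length s = 4" and s_sign: "\<And>a. a \<in> set s \<Longrightarrow> a = 1 \<or> a = -1"
    and s_prod: "prod_list s = 1"
    using s by (auto simp: mem_even_sign_lists)
  let ?q = "code_perm p"
  define e where "e i = real_of_int (s ! index4 (inv' ?q i))" for i
  have q: "?q permutes UNIV" by (rule code_perm_permutes(1)[OF p])
  have "code_mat v $ i $ j = signed_perm_mat e ?q $ i $ j" for i j
    by (cases "i = ?q j") (simp_all add: code_mat_entry signed_perm_mat_entry v
        code_perm_permutes(2)[OF p] e_def permutes_inverses(2)[OF q])
  then have "code_mat v = signed_perm_mat e ?q" by (simp add: vec_eq_iff)
  moreover have "even_signs_perm e ?q"
  proof -
    have "(\<Prod>i\<in>UNIV. e i) = (\<Prod>j\<in>UNIV. real_of_int (s ! index4 j))"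
      using prod.permute[OF q, of e] by (simp add: e_def o_def permutes_inverses(2)[OF q])
    then have "(\<Prod>i\<in>UNIV. e i) = 1" using s_prod prod_index4[OF s_len] by simp
    moreover have "e i \<in> {1, -1}" for i
    proof -
      have "s ! index4 (inv' ?q i) \<in> set s" using s_len by simp
      then have "s ! index4 (inv' ?q i) = 1 \<or> s ! index4 (inv' ?q i) = -1" by (rule s_sign)
      then show ?thesis by (auto simp: e_def)
    qed
    ultimately show ?thesis using q by (simp add: even_signs_perm_def)
  qed
  ultimately show ?thesis unfolding carrier_W_D4 by blast
qed

lemma code_mat_surj:
  assumes "x \<in> carrier W_D4"
  shows "\<exists>v\<in>set W_codes. code_mat v = x"
proof -
  obtain e p where x: "x = signed_perm_mat e p" and ep: "even_signs_perm e p"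
    using assms by (auto simp: carrier_W_D4)
  have p: "p permutes UNIV" and e: "\<And>i. e i = 1 \<or> e i = -1" and e_prod: "(\<Prod>i\<in>UNIV. e i) = 1"
    using ep by (auto simp: even_signs_perm_def)
  define sign_of :: "real \<Rightarrow> int" where "sign_of r = (if r = 1 then 1 else -1)" for r
  have sign_of: "real_of_int (sign_of (e i)) = e i" for i
    using e[of i] by (auto simp: sign_of_def)
  define s where "s = map (\<lambda>c. sign_of (e (p (elem4 c)))) [0..<4]"
  define q where "q = map (\<lambda>c. index4 (p (elem4 c))) [0..<4]"
  have "code_mat (s, q) = x"
    unfolding x by (simp add: vec_eq_iff code_mat_entry signed_perm_mat_entry s_def q_def sign_of)
  moreover have "q \<in> set perm_lists"
  proof -
    have "inj_on (\<lambda>c. index4 (p (elem4 c))) {0..<4}"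
    proof (rule inj_onI)
      fix a b assume ab: "a \<in> {0..<4}" "b \<in> {0..<4}" and "index4 (p (elem4 a)) = index4 (p (elem4 b))"
      then have "elem4 a = elem4 b" using permutes_inj[OF p] by (simp add: inj_def)
      then show "a = b" using ab by (metis atLeastLessThan_iff index4_elem4)
    qed
    moreover have "set q \<subseteq> {..<4}" by (auto simp: q_def)
    moreover have "{..<4} = {0, 1, 2, 3::nat}" by auto
    ultimately show ?thesis by (simp add: mem_perm_lists q_def distinct_map)
  qed
  moreover have "s \<in> set even_sign_lists"
  proof -
    have "real_of_int (prod_list s) = (\<Prod>i\<in>UNIV. e (p i))"
      unfolding UNIV_4 by (simp add: s_def upt_rec sign_of elem4_def)
    also have "\<dots> = 1" using prod.permute[OF p, of e] e_prod by (simp add: o_def)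
    finally have "prod_list s = 1" by simp
    moreover have "set s \<subseteq> {1, -1}" by (auto simp: s_def sign_of_def)
    ultimately show ?thesis by (simp add: mem_even_sign_lists s_def)
  qed
  ultimately show ?thesis by (auto simp: mem_W_codes)
qed

lemma carrier_W_D4_codes: "carrier W_D4 = code_mat ` set W_codes"
  using code_mat_surj code_mat_in_carrier by blast

definition one_code :: code where "one_code = ([1, 1, 1, 1], [0, 1, 2, 3])"

definition neg_code :: code where "neg_code = ([-1, -1, -1, -1], [0, 1, 2, 3])"

definition neg_one :: "real^4^4" where "neg_one = (-1::real) *\<^sub>R mat 1"

lemma code_mat_one_code: "code_mat one_code = mat 1"
  unfolding vec_eq_iff forall_4 by (simp add: code_mat_entry one_code_def mat_def index4_def)

lemma code_mat_neg_code: "code_mat neg_code = neg_one"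
  unfolding vec_eq_iff forall_4 by (simp add: code_mat_entry neg_code_def neg_one_def mat_def index4_def)

text \<open>The Coxeter generators of W(D4): the transpositions of the first three pairs of adjacent
  coordinates, and the last transposition combined with the sign change of both its coordinates.
  The second generator is the branch node of the Dynkin diagram.\<close>

definition gen_codes :: "code list" where
  "gen_codes = [([1,1,1,1], [1,0,2,3]), ([1,1,1,1], [0,2,1,3]), ([1,1,1,1], [0,1,3,2]),
                ([1,1,-1,-1], [0,1,3,2])]"

definition gen :: "nat \<Rightarrow> real^4^4" where
  "gen i = code_mat (gen_codes ! i)"

definition word_code :: "nat list \<Rightarrow> code" where
  "word_code ws = foldl (\<lambda>v i. code_mult v (gen_codes ! i)) one_code ws"

definition gen_words :: "nat list list" where
  "gen_words = [[0, 1, 0, 2, 1, 0], [0, 3, 1, 0, 2, 1], [1, 0, 3, 1, 0, 2], [2, 1, 0, 3, 1, 2], [0, 1, 0, 3, 1, 0], [0, 2, 1, 0, 3, 1], [1, 0, 2, 1, 0, 3], [3, 1, 0, 2, 1, 3], [0, 1, 0, 2, 1], [0, 2, 3, 1, 0, 2, 1], [2, 1, 0, 3, 1, 0, 2], [1, 0, 3, 1, 2], [0, 2, 1, 0, 3, 1, 0], [0, 1, 0, 3, 1], [1, 0, 2, 1, 3], [2, 3, 1, 0, 2, 1, 3], [0, 1, 2, 1, 0], [1, 0, 3, 1, 0, 2, 1], [0, 3, 1, 0, 2], [1, 2, 1, 0, 3, 1, 2], [0, 1, 3, 1, 0], [1, 0, 2, 1, 0, 3, 1], [0, 2, 1, 0,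 3], [1, 3, 1, 0, 2, 1, 3], [0, 1, 2, 1], [1, 0, 2, 3, 1, 0, 2, 1], [1, 2, 1, 0, 3, 1, 0, 2], [0, 3, 1, 2], [1, 0, 2, 1, 0, 3, 1, 0], [0, 1, 3, 1], [0, 2, 1, 3], [1, 2, 3, 1, 0, 2, 1, 3], [0, 1, 0, 2], [2, 1, 0, 3, 1, 0, 2, 1], [0, 2, 3, 1, 0, 2], [1, 0, 2, 3, 1, 2], [0, 2, 1, 3, 1, 0], [1, 0, 2, 1, 3, 1], [0, 1, 0, 3], [2, 1, 3, 1, 0, 2, 1, 3], [0, 1, 2], [1, 2, 1, 0, 3, 1, 0, 2, 1], [1, 0, 2, 3, 1, 0, 2], [0, 2, 3, 1, 2], [1, 0, 2, 1, 3, 1, 0], [0, 2, 1, 3, 1], [0, 1, 3], [1, 2, 1, 3, 1, 0, 2, 1, 3], [1, 0, 2, 1, 0], [3, 1, 0, 2, 1], [0, 1, 0, 3, 1, 0, 2], [0, 2, 1, 0, 3, 1, 2], [1, 0, 3, 1, 0], [2, 1, 0, 3, 1], [0, 1, 0, 2, 1, 0, 3], [0, 3, 1, 0, 2, 1, 3], [1, 0, 2, 1], [2, 3, 1, 0, 2, 1], [0, 2, 1, 0, 3, 1, 0, 2], [0, 1, 0, 3, 1, 2], [2, 1, 0, 3, 1, 0], [1, 0, 3, 1], [0, 1, 0, 2, 1, 3], [0, 2, 3, 1, 0, 2, 1, 3], [1, 2, 1, 0], [0, 1, 0, 3, 1, 0, 2, 1], [3, 1, 0, 2], [0, 1, 2,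 1, 0, 3, 1, 2], [1, 3, 1, 0], [0, 1, 0, 2, 1, 0, 3, 1], [2, 1, 0, 3], [0, 1, 3, 1, 0, 2, 1, 3], [1, 2, 1], [0, 1, 0, 2, 3, 1, 0, 2, 1], [0, 1, 2, 1, 0, 3, 1, 0, 2], [3, 1, 2], [0, 1, 0, 2, 1, 0, 3, 1, 0], [1, 3, 1], [2, 1, 3], [0, 1, 2, 3, 1, 0, 2, 1, 3], [1, 0, 2], [0, 2, 1, 0, 3, 1, 0, 2, 1], [2, 3, 1, 0, 2], [0, 1, 0, 2, 3, 1, 2], [2, 1, 3, 1, 0], [0, 1, 0, 2, 1, 3, 1], [1, 0, 3], [0, 2, 1, 3, 1, 0, 2, 1, 3], [1, 2], [0, 1, 2, 1, 0, 3, 1, 0, 2, 1], [0, 1, 0, 2, 3, 1, 0, 2], [2, 3, 1, 2], [0, 1, 0, 2, 1, 3, 1, 0], [2, 1, 3, 1], [1, 3], [0, 1, 2, 1, 3, 1, 0, 2, 1, 3], [0, 2, 1, 0], [1, 3, 1, 0, 2, 1], [0, 1, 3, 1, 0, 2], [1, 0, 2, 1, 0, 3, 1, 2], [0, 3, 1, 0], [1, 2, 1, 0, 3, 1], [0, 1, 2, 1, 0, 3], [1, 0, 3, 1, 0, 2, 1, 3], [0, 2, 1], [1, 2, 3, 1, 0, 2, 1], [1, 0, 2, 1, 0, 3, 1, 0, 2], [0, 1, 3, 1, 2], [1, 2, 1, 0, 3, 1, 0], [0, 3, 1], [0, 1, 2, 1, 3], [1, 0, 2, 3, 1, 0, 2,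 1, 3], [2, 1, 0], [0, 1, 3, 1, 0, 2, 1], [1, 3, 1, 0, 2], [0, 1, 0, 2, 1, 0, 3, 1, 2], [3, 1, 0], [0, 1, 2, 1, 0, 3, 1], [1, 2, 1, 0, 3], [0, 1, 0, 3, 1, 0, 2, 1, 3], [2, 1], [0, 1, 2, 3, 1, 0, 2, 1], [0, 1, 0, 2, 1, 0, 3, 1, 0, 2], [1, 3, 1, 2], [0, 1, 2, 1, 0, 3, 1, 0], [3, 1], [1, 2, 1, 3], [0, 1, 0, 2, 3, 1, 0, 2, 1, 3], [0, 2], [1, 0, 2, 1, 0, 3, 1, 0, 2, 1], [1, 2, 3, 1, 0, 2], [0, 1, 2, 3, 1, 2], [1, 2, 1, 3, 1, 0], [0, 1, 2, 1, 3, 1], [0, 3], [1, 0, 2, 1, 3, 1, 0, 2, 1, 3], [2], [0, 1, 0, 2, 1, 0, 3, 1, 0, 2, 1], [0, 1, 2, 3, 1, 0, 2], [1, 2, 3, 1, 2], [0, 1, 2, 1, 3, 1, 0], [1, 2, 1, 3, 1], [3], [0, 1, 0, 2, 1, 3, 1, 0, 2, 1, 3], [0, 1, 0], [2, 1, 3, 1, 0, 2, 1], [0, 2, 1, 3, 1, 0, 2], [1, 0, 2, 1, 3, 1, 2], [0, 2, 3, 1, 0], [1, 0, 2, 3, 1], [0, 1, 0, 2, 3], [2, 1, 0, 3, 1, 0, 2, 1, 3], [0, 1], [1, 2, 1, 3, 1, 0, 2, 1], [1, 0, 2, 1, 3, 1, 0, 2], [0, 2, 1, 3, 1, 2], [1,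 0, 2, 3, 1, 0], [0, 2, 3, 1], [0, 1, 2, 3], [1, 2, 1, 0, 3, 1, 0, 2, 1, 3], [1, 0], [0, 2, 1, 3, 1, 0, 2, 1], [2, 1, 3, 1, 0, 2], [0, 1, 0, 2, 1, 3, 1, 2], [2, 3, 1, 0], [0, 1, 0, 2, 3, 1], [1, 0, 2, 3], [0, 2, 1, 0, 3, 1, 0, 2, 1, 3], [1], [0, 1, 2, 1, 3, 1, 0, 2, 1], [0, 1, 0, 2, 1, 3, 1, 0, 2], [2, 1, 3, 1, 2], [0, 1, 0, 2, 3, 1, 0], [2, 3, 1], [1, 2, 3], [0, 1, 2, 1, 0, 3, 1, 0, 2, 1, 3], [0], [1, 0, 2, 1, 3, 1, 0, 2, 1], [1, 2, 1, 3, 1, 0, 2], [0, 1, 2, 1, 3, 1, 2], [1, 2, 3, 1, 0], [0, 1, 2, 3, 1], [0, 2, 3], [1, 0, 2, 1, 0, 3, 1, 0, 2, 1, 3], [], [0, 1, 0, 2, 1, 3, 1, 0, 2, 1], [0, 1, 2, 1, 3, 1, 0, 2], [1, 2, 1, 3, 1, 2], [0, 1, 2, 3, 1, 0], [1, 2, 3, 1], [2, 3], [0, 1, 0, 2, 1, 0, 3, 1, 0, 2, 1, 3]]"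

lemma W_codes_gen_words: "W_codes = map word_code gen_words"
  by code_simp

lemma gen_words_less_4: "list_all (list_all (\<lambda>i. i < 4)) gen_words"
  by code_simp

lemma special_codes_W_codes: "set gen_codes \<subseteq> set W_codes" "one_code \<in> set W_codes" "neg_code \<in> set W_codes"
  by code_simp+

lemma gen_codes_W_codes: "i < 4 \<Longrightarrow> gen_codes ! i \<in> set W_codes"
  using special_codes_W_codes(1) by (auto simp: gen_codes_def dest!: less_4_cases)

lemma gen_carrier: "i < 4 \<Longrightarrow> gen i \<in> carrier W_D4"
  by (simp add: gen_def code_mat_in_carrier gen_codes_W_codes)

lemma neg_one_carrier: "neg_one \<in> carrier W_D4"
  using code_mat_in_carrier[OF special_codes_W_codes(3)] by (simp add: code_mat_neg_code)

lemma code_mat_word_code: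
  assumes "list_all (\<lambda>i. i < 4) ws"
  shows "code_wf (word_code ws) \<and> code_mat (word_code ws) = foldl (\<lambda>x i. x ** gen i) (mat 1) ws"
  using assms
proof (induction ws rule: rev_induct)
  case Nil
  show ?case using W_codes_wf special_codes_W_codes(2)
    by (simp add: word_code_def code_mat_one_code)
next
  case (snoc i ws)
  then have "code_wf (gen_codes ! i)" using W_codes_wf gen_codes_W_codes by simp
  with snoc show ?case
    by (simp add: word_code_def code_mult_wf code_mat_mult[symmetric] gen_def)
qed

lemma gen_induct [consumes 1, case_names one step]:
  assumes x: "x \<in> carrier W_D4" and one: "P (mat 1)"
    and step: "\<And>y i. y \<in> carrier W_D4 \<Longrightarrow> P y \<Longrightarrow> i < 4 \<Longrightarrow> P (y ** gen i)"
  shows "P x"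
proof -
  obtain ws where ws: "list_all (\<lambda>i. i < 4) ws" and x_ws: "x = code_mat (word_code ws)"
    using x gen_words_less_4 by (auto simp: carrier_W_D4_codes W_codes_gen_words list_all_iff)
  have "foldl (\<lambda>x i. x ** gen i) (mat 1) ws \<in> carrier W_D4 \<and> P (foldl (\<lambda>x i. x ** gen i) (mat 1) ws)"
    using ws
  proof (induction ws rule: rev_induct)
    case (snoc i ws)
    then show ?case using step W.m_closed gen_carrier by simp
  qed (use one W.one_closed in simp)
  then show ?thesis using code_mat_word_code[OF ws] x_ws by simp
qed

definition code_of :: "real^4^4 \<Rightarrow> code" where
  "code_of x = (SOME v. v \<in> set W_codes \<and> code_mat v = x)"

lemma code_of_code_mat: "v \<in> set W_codes \<Longrightarrow> code_of (code_mat v) = v"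
  unfolding code_of_def by (rule some_equality) (auto simp: code_mat_eq_iff)

lemma code_mat_mult_W_codes:
  "v \<in> set W_codes \<Longrightarrow> w \<in> set W_codes \<Longrightarrow> code_mat v ** code_mat w = code_mat (code_mult v w)"
  using code_mat_mult W_codes_wf by blast

lemma code_mult_W_codes:
  assumes v: "v \<in> set W_codes" and w: "w \<in> set W_codes"
  shows "code_mult v w \<in> set W_codes"
proof -
  have "code_mat v ** code_mat w \<in> carrier W_D4"
    using W.m_closed code_mat_in_carrier v w by simp
  then obtain u where u: "u \<in> set W_codes" "code_mat (code_mult v w) = code_mat u"
    using code_mat_surj code_mat_mult_W_codes[OF v w] by metis
  then have "code_mult v w = u"
    using code_mat_inj code_mult_wf W_codes_wf v w by blast
  with u show ?thesis by simp
qed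

section \<open>Conjugacy classes of involutions\<close>

definition involution_codes :: "code list" where
  "involution_codes = filter (\<lambda>v. code_mult v v = one_code \<and> v \<noteq> one_code \<and> v \<noteq> neg_code) W_codes"

text \<open>The five conjugacy classes of non-central involutions: 1 = sign changes of two coordinates,
  2 and 3 = double transpositions with constant resp. non-constant signs, 4 and 5 = transpositions
  whose two fixed coordinates keep resp. change their sign. Classes 1--3 have six elements each,
  classes 4 and 5 twelve.\<close>

fun code_class :: "code \<Rightarrow> nat" where
  "code_class (s, p) =
     (let fixed = filter (\<lambda>c. p ! c = c) [0..<4] in
      if length fixed = 4 then 1
      else if fixed = [] then (if s = [1, 1, 1, 1] \<or> s = [-1, -1, -1, -1] then 2 else 3)
      else if list_all (\<lambda>c. s ! c = 1) fixed then 4 else 5)"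

definition class_rep_code :: "nat \<Rightarrow> code" where
  "class_rep_code k =
     (if k = 1 then code_mult (gen_codes ! 2) (gen_codes ! 3)
      else if k = 2 then code_mult (gen_codes ! 0) (gen_codes ! 2)
      else if k = 3 then code_mult (gen_codes ! 0) (gen_codes ! 3)
      else if k = 4 then gen_codes ! 0
      else code_mult neg_code (gen_codes ! 0))"

definition conj_witness_codes :: "code list" where
  "conj_witness_codes = [([1,1,1,1],[1,3,2,0]), ([1,1,1,1],[1,3,2,0]), ([-1,-1,1,1],[1,3,2,0]), ([-1,-1,1,1],[1,3,2,0]), ([1,1,1,1],[1,3,2,0]), ([-1,-1,1,1],[1,3,2,0]), ([-1,-1,1,1],[1,3,2,0]), ([1,1,1,1],[1,3,2,0]), ([1,1,1,1],[3,1,2,0]), ([1,1,1,1],[3,1,2,0]), ([-1,-1,1,1],[3,1,2,0]), ([-1,-1,1,1],[3,1,2,0]), ([1,1,1,1],[3,1,2,0]), ([-1,-1,1,1],[3,1,2,0]), ([-1,-1,1,1],[3,1,2,0]), ([1,1,1,1],[3,1,2,0]), ([1,1,1,1],[3,2,1,0]), ([1,1,1,1],[3,2,1,0]), ([-1,1,-1,1],[3,2,1,0]), ([-1,1,-1,1],[3,2,1,0]), ([1,1,1,1],[3,2,1,0]), ([-1,1,-1,1],[3,2,1,0]), ([-1,1,-1,1],[3,2,1,0]), ([1,1,1,1],[3,2,1,0]), ([1,1,1,1],[1,3,0,2]), ([-1,-1,1,1],[1,3,0,2]), ([-1,-1,1,1],[1,3,0,2]), ([1,1,1,1],[1,3,0,2]),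 ([1,1,1,1],[3,1,0,2]), ([-1,-1,1,1],[3,1,0,2]), ([-1,-1,1,1],[3,1,0,2]), ([1,1,1,1],[3,1,0,2]), ([1,1,1,1],[1,0,3,2]), ([-1,1,-1,1],[1,0,3,2]), ([-1,1,-1,1],[1,0,3,2]), ([1,1,1,1],[1,0,3,2]), ([1,1,1,1],[3,2,1,0]), ([1,1,1,1],[3,1,2,0]), ([1,1,1,1],[1,3,2,0]), ([1,1,1,1],[3,1,0,2]), ([1,1,1,1],[1,3,0,2]), ([1,1,1,1],[1,0,3,2])]"

lemma involution_codes_gen_conj:
  "list_all (\<lambda>v. list_all (\<lambda>g. code_mult (code_mult g v) g \<in> set involution_codes
       \<and> code_class (code_mult (code_mult g v) g) = code_class v) gen_codes) involution_codes"
  by code_simp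

lemma gen_codes_involutive: "list_all (\<lambda>g. code_mult g g = one_code) gen_codes"
  by code_simp

lemma neg_code_central: "list_all (\<lambda>v. code_mult neg_code v = code_mult v neg_code) W_codes"
  by code_simp

lemma neg_code_class:
  "list_all (\<lambda>v. code_mult neg_code v \<in> set involution_codes
       \<and> code_class (code_mult neg_code v) = Transposition.transpose 4 5 (code_class v)) involution_codes"
  by code_simp

lemma gen_centralizer_codes:
  "list_all (\<lambda>v. list_all (\<lambda>g. code_mult v g = code_mult g v) gen_codes \<longrightarrow> v = one_code \<or> v = neg_code)
     W_codes"
  by code_simp

lemma class_rep_codes:
  "list_all (\<lambda>k. class_rep_code k \<in> set involution_codes \<and> code_class (class_rep_code k) = k) [1..<6]"
  by code_simp

lemma conj_witness_codes:
  "list_all2 (\<lambda>v g. g \<in> set W_codes \<and> code_mult g v = code_mult (class_rep_code (code_class v)) g)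
     involution_codes conj_witness_codes"
  by code_simp

lemma code_class_range: "code_class v \<in> {1..5}"
  by (cases v) (simp add: Let_def)

definition involutions :: "(real^4^4) set" where
  "involutions = {x \<in> carrier W_D4. x ** x = mat 1 \<and> x \<noteq> mat 1 \<and> x \<noteq> neg_one}"

definition involution_class :: "real^4^4 \<Rightarrow> nat" where
  "involution_class x = code_class (code_of x)"

definition class_rep :: "nat \<Rightarrow> real^4^4" where
  "class_rep k = code_mat (class_rep_code k)"

lemma involution_class_range: "involution_class x \<in> {1..5}"
  unfolding involution_class_def by (rule code_class_range)

lemma involution_class_code_mat: "v \<in> set W_codes \<Longrightarrow> involution_class (code_mat v) = code_class v"
  by (simp add: involution_class_def code_of_code_mat)

lemma involution_codes_W_codes: "v \<in> set involution_codes \<Longrightarrow> v \<in> set W_codes"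
  by (simp add: involution_codes_def)

lemma code_mat_in_involutions:
  assumes v: "v \<in> set W_codes"
  shows "code_mat v \<in> involutions \<longleftrightarrow> v \<in> set involution_codes"
proof -
  have "code_mat v ** code_mat v = mat 1 \<longleftrightarrow> code_mult v v = one_code"
    using v code_mult_W_codes[OF v v] special_codes_W_codes(2)
    by (simp add: code_mat_mult_W_codes code_mat_one_code[symmetric] code_mat_eq_iff)
  moreover have "code_mat v = mat 1 \<longleftrightarrow> v = one_code"
    using v special_codes_W_codes(2) by (simp add: code_mat_one_code[symmetric] code_mat_eq_iff)
  moreover have "code_mat v = neg_one \<longleftrightarrow> v = neg_code"
    using v special_codes_W_codes(3) by (simp add: code_mat_neg_code[symmetric] code_mat_eq_iff)
  ultimately show ?thesis
    using v code_mat_in_carrier by (auto simp: involutions_def involution_codes_def)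
qed

lemma involutions_carrier: "x \<in> involutions \<Longrightarrow> x \<in> carrier W_D4"
  by (simp add: involutions_def)

lemma involutions_codes: "involutions = code_mat ` set involution_codes"
proof (rule equalityI; rule subsetI)
  fix x assume x: "x \<in> involutions"
  then obtain v where "v \<in> set W_codes" "code_mat v = x"
    using code_mat_surj involutions_carrier by blast
  then show "x \<in> code_mat ` set involution_codes" using x code_mat_in_involutions by blast
next
  fix x assume "x \<in> code_mat ` set involution_codes"
  then obtain v where "v \<in> set involution_codes" "x = code_mat v" by blast
  then show "x \<in> involutions" using code_mat_in_involutions involution_codes_W_codes by blast
qed

lemma gen_codes_nth: "i < 4 \<Longrightarrow> gen_codes ! i \<in> set gen_codes"
  by (rule nth_mem) (simp add: gen_codes_def)

lemma gen_involutive: "i < 4 \<Longrightarrow> gen i ** gen i = mat 1"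
  using gen_codes_involutive gen_codes_W_codes
  by (simp add: list_all_iff gen_def code_mat_mult_W_codes gen_codes_nth code_mat_one_code)

lemma inv_gen: "i < 4 \<Longrightarrow> inv\<^bsub>W_D4\<^esub> (gen i) = gen i"
  using W.inv_equality[of "gen i" "gen i"] gen_involutive gen_carrier by simp

lemma gen_conj_class:
  assumes x: "x \<in> involutions" and i: "i < 4"
  shows "gen i ** x ** gen i \<in> involutions \<and> involution_class (gen i ** x ** gen i) = involution_class x"
proof -
  obtain v where v: "v \<in> set involution_codes" "x = code_mat v"
    using x by (auto simp: involutions_codes)
  let ?g = "gen_codes ! i"
  have vW: "v \<in> set W_codes" and gW: "?g \<in> set W_codes"
    using v(1) gen_codes_W_codes[OF i] by (simp_all add: involution_codes_W_codes)
  have "gen i ** x ** gen i = code_mat (code_mult (code_mult ?g v) ?g)"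
    using vW gW by (simp add: v(2) gen_def code_mat_mult_W_codes code_mult_W_codes)
  moreover have "code_mult (code_mult ?g v) ?g \<in> set involution_codes
      \<and> code_class (code_mult (code_mult ?g v) ?g) = code_class v"
    using involution_codes_gen_conj v(1) gen_codes_nth[OF i] by (simp add: list_all_iff)
  ultimately show ?thesis
    using v vW by (simp add: involutions_codes involution_class_code_mat involution_codes_W_codes)
qed

lemma conj_class:
  assumes "g \<in> carrier W_D4"
  shows "\<forall>x\<in>involutions. g ** x ** inv\<^bsub>W_D4\<^esub> g \<in> involutions
           \<and> involution_class (g ** x ** inv\<^bsub>W_D4\<^esub> g) = involution_class x"
  using assms
proof (induction g rule: gen_induct)
  case one
  have "inv\<^bsub>W_D4\<^esub> (mat 1) = mat 1" using W.inv_one by simp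
  then show ?case by simp
next
  case (step y i)
  show ?case
  proof
    fix x assume x: "x \<in> involutions"
    have "inv\<^bsub>W_D4\<^esub> (y ** gen i) = gen i ** inv\<^bsub>W_D4\<^esub> y"
      using W.inv_mult_group[OF \<open>y \<in> carrier W_D4\<close> gen_carrier[OF \<open>i < 4\<close>]] inv_gen[OF \<open>i < 4\<close>]
      by simp
    then have "y ** gen i ** x ** inv\<^bsub>W_D4\<^esub> (y ** gen i) = y ** (gen i ** x ** gen i) ** inv\<^bsub>W_D4\<^esub> y"
      by (simp add: matrix_mul_assoc)
    then show "y ** gen i ** x ** inv\<^bsub>W_D4\<^esub> (y ** gen i) \<in> involutions
        \<and> involution_class (y ** gen i ** x ** inv\<^bsub>W_D4\<^esub> (y ** gen i)) = involution_class x"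
      using gen_conj_class[OF x \<open>i < 4\<close>] step.IH by simp
  qed
qed

lemma class_rep_class: "k \<in> {1..5} \<Longrightarrow> class_rep k \<in> involutions \<and> involution_class (class_rep k) = k"
  using class_rep_codes
  by (auto simp: list_all_iff class_rep_def involutions_codes involution_class_code_mat involution_codes_W_codes)

lemma conjugate_class_rep:
  assumes x: "x \<in> involutions"
  shows "conjugate W_D4 x (class_rep (involution_class x))"
proof -
  obtain n where n: "n < length involution_codes" and x_n: "x = code_mat (involution_codes ! n)"
    using x by (auto simp: involutions_codes in_set_conv_nth)
  define v where "v = involution_codes ! n"
  define g where "g = conj_witness_codes ! n"
  have v: "v \<in> set involution_codes" using n by (simp add: v_def)
  then have vW: "v \<in> set W_codes" by (rule involution_codes_W_codes)
  have gW: "g \<in> set W_codes" and comm: "code_mult g v = code_mult (class_rep_code (code_class v)) g"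
    using conj_witness_codes n by (auto simp: list_all2_conv_all_nth v_def g_def)
  have rW: "class_rep_code (code_class v) \<in> set W_codes"
    using class_rep_codes code_class_range[of v] involution_codes_W_codes by (auto simp: list_all_iff)
  have "code_mat g ** x = class_rep (involution_class x) ** code_mat g"
    using comm gW vW rW
    by (simp add: x_n v_def[symmetric] code_mat_mult_W_codes class_rep_def involution_class_code_mat)
  then have "code_mat g ** x ** inv\<^bsub>W_D4\<^esub> (code_mat g) = class_rep (involution_class x)"
    using W.conjugate_if_commute[of "code_mat g" x "class_rep (involution_class x)"] code_mat_in_carrier[OF gW]
      involutions_carrier[OF x] class_rep_class[OF involution_class_range] involutions_carrier by simp
  then show ?thesis using code_mat_in_carrier[OF gW] by (auto simp: conjugate_def)
qed

lemma conjugate_iff_same_class: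
  assumes x: "x \<in> involutions" and y: "y \<in> involutions"
  shows "conjugate W_D4 x y \<longleftrightarrow> involution_class x = involution_class y"
proof
  assume "conjugate W_D4 x y"
  then show "involution_class x = involution_class y"
    using conj_class x by (auto simp: conjugate_def)
next
  assume same: "involution_class x = involution_class y"
  have "conjugate W_D4 (class_rep (involution_class y)) y"
    using W.conjugate_sym conjugate_class_rep[OF y] involutions_carrier[OF y] by blast
  then show "conjugate W_D4 x y"
    using W.conjugate_trans conjugate_class_rep[OF x] involutions_carrier[OF x] same by metis
qed

lemma neg_one_central: "x \<in> carrier W_D4 \<Longrightarrow> neg_one ** x = x ** neg_one"
  using neg_code_central special_codes_W_codes(3)
  by (auto simp: carrier_W_D4_codes list_all_iff code_mat_neg_code[symmetric] code_mat_mult_W_codes)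

lemma neg_one_ne_one: "neg_one \<noteq> mat 1"
  using special_codes_W_codes(2,3)
  by (simp add: code_mat_neg_code[symmetric] code_mat_one_code[symmetric] code_mat_eq_iff one_code_def neg_code_def)

lemma neg_one_class:
  assumes x: "x \<in> involutions"
  shows "neg_one ** x \<in> involutions \<and> involution_class (neg_one ** x) = Transposition.transpose 4 5 (involution_class x)"
proof -
  obtain v where v: "v \<in> set involution_codes" "x = code_mat v"
    using x by (auto simp: involutions_codes)
  have "code_mult neg_code v \<in> set involution_codes
      \<and> code_class (code_mult neg_code v) = Transposition.transpose 4 5 (code_class v)"
    using neg_code_class v(1) by (simp add: list_all_iff)
  then show ?thesis
    using v special_codes_W_codes(3) involution_codes_W_codes[OF v(1)]
    by (simp add: code_mat_neg_code[symmetric] code_mat_mult_W_codes involutions_codes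
        involution_class_code_mat involution_codes_W_codes)
qed

lemma gen_centralizer:
  assumes x: "x \<in> carrier W_D4" and comm: "\<And>i. i < 4 \<Longrightarrow> x ** gen i = gen i ** x"
  shows "x = mat 1 \<or> x = neg_one"
proof -
  obtain v where v: "v \<in> set W_codes" "x = code_mat v"
    using code_mat_surj x by metis
  have "code_mult v g = code_mult g v" if "g \<in> set gen_codes" for g
  proof -
    have "length gen_codes = 4" by (simp add: gen_codes_def)
    with that obtain i where i: "i < 4" "g = gen_codes ! i" by (auto simp: in_set_conv_nth)
    then show ?thesis
      using comm[OF i(1)] v gen_codes_W_codes[OF i(1)]
      by (simp add: gen_def code_mat_mult_W_codes code_mat_eq_iff code_mult_W_codes)
  qed
  then have "v = one_code \<or> v = neg_code"
    using gen_centralizer_codes v(1) by (auto simp: list_all_iff)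
  then show ?thesis using v(2) by (auto simp: code_mat_one_code code_mat_neg_code)
qed

section \<open>The action of automorphisms on the classes\<close>

lemma auto_fixes_neg_one:
  assumes a: "a \<in> auto W_D4"
  shows "a neg_one = neg_one"
proof -
  interpret a: group_hom W_D4 W_D4 a by (rule W.auto_group_hom[OF a])
  have "a neg_one ** gen i = gen i ** a neg_one" if "i < 4" for i
    using W.auto_central[OF a neg_one_carrier _ gen_carrier[OF that]] neg_one_central by simp
  then have "a neg_one = mat 1 \<or> a neg_one = neg_one"
    using gen_centralizer a.hom_closed[OF neg_one_carrier] by simp
  moreover have "a neg_one \<noteq> a (mat 1)"
    using inj_onD[OF W.auto_inj_on[OF a]] neg_one_carrier W.one_closed neg_one_ne_one by fastforce
  ultimately show ?thesis using a.hom_one by simp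
qed

lemma auto_involutions_iff:
  assumes a: "a \<in> auto W_D4" and x: "x \<in> carrier W_D4"
  shows "a x \<in> involutions \<longleftrightarrow> x \<in> involutions"
proof -
  interpret a: group_hom W_D4 W_D4 a by (rule W.auto_group_hom[OF a])
  have inj: "a y = a z \<longleftrightarrow> y = z" if "y \<in> carrier W_D4" "z \<in> carrier W_D4" for y z
    using inj_onD[OF W.auto_inj_on[OF a]] that by blast
  have "a x ** a x = a (mat 1) \<longleftrightarrow> x ** x = mat 1"
    using a.hom_mult[OF x x] inj[of "x ** x" "mat 1"] x W.m_closed W.one_closed by simp
  moreover have "a x = a (mat 1) \<longleftrightarrow> x = mat 1" using inj x W.one_closed by simp
  moreover have "a x = a neg_one \<longleftrightarrow> x = neg_one" using inj x neg_one_carrier by simp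
  ultimately show ?thesis
    using a.hom_closed[OF x] x a.hom_one auto_fixes_neg_one[OF a] by (simp add: involutions_def)
qed

definition class_action :: "(real^4^4 \<Rightarrow> real^4^4) \<Rightarrow> nat \<Rightarrow> nat" where
  "class_action a k = involution_class (a (class_rep k))"

lemma class_action_range: "class_action a k \<in> {1..5}"
  unfolding class_action_def by (rule involution_class_range)

lemma involution_class_auto:
  assumes a: "a \<in> auto W_D4" and x: "x \<in> involutions"
  shows "involution_class (a x) = class_action a (involution_class x)"
proof -
  have r: "class_rep (involution_class x) \<in> involutions"
    using class_rep_class[OF involution_class_range] by blast
  have "conjugate W_D4 (a x) (a (class_rep (involution_class x)))"
    using W.auto_conjugate[OF a conjugate_class_rep[OF x] involutions_carrier[OF x]] .
  then show ?thesis
    using conjugate_iff_same_class auto_involutions_iff[OF a] involutions_carrier x r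
    by (simp add: class_action_def)
qed

lemma class_action_transpose45:
  assumes a: "a \<in> auto W_D4" and k: "k \<in> {1..5}"
  shows "class_action a (Transposition.transpose 4 5 k) = Transposition.transpose 4 5 (class_action a k)"
proof -
  interpret a: group_hom W_D4 W_D4 a by (rule W.auto_group_hom[OF a])
  have r: "class_rep k \<in> involutions" "involution_class (class_rep k) = k"
    using class_rep_class[OF k] by simp_all
  have n: "neg_one ** class_rep k \<in> involutions"
    "involution_class (neg_one ** class_rep k) = Transposition.transpose 4 5 k"
    using neg_one_class[OF r(1)] r(2) by simp_all
  have "a (neg_one ** class_rep k) = neg_one ** a (class_rep k)"
    using a.hom_mult[OF neg_one_carrier involutions_carrier[OF r(1)]] auto_fixes_neg_one[OF a] by simp
  then have "involution_class (a (neg_one ** class_rep k)) = Transposition.transpose 4 5 (class_action a k)"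
    using neg_one_class auto_involutions_iff[OF a] involutions_carrier r(1)
    by (simp add: class_action_def)
  then show ?thesis using involution_class_auto[OF a n(1)] n(2) by simp
qed

lemma class_action_small:
  assumes a: "a \<in> auto W_D4" and k: "k \<in> {1..3}"
  shows "class_action a k \<in> {1..3}"
proof -
  have "Transposition.transpose 4 5 k = k" using k by (auto simp: Transposition.transpose_def)
  then have "class_action a k = class_action a (Transposition.transpose 4 5 k)" by simp
  also have "\<dots> = Transposition.transpose 4 5 (class_action a k)"
    by (rule class_action_transpose45[OF a]) (use k in auto)
  finally have "class_action a k = Transposition.transpose 4 5 (class_action a k)" .
  then show ?thesis using class_action_range[of a k] by (auto simp: Transposition.transpose_def split: if_splits)
qed

lemma class_action_compose:
  assumes a: "a \<in> auto W_D4" and b: "b \<in> auto W_D4" and k: "k \<in> {1..5}"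
  shows "class_action (compose (carrier W_D4) a b) k = class_action a (class_action b k)"
proof -
  have r: "class_rep k \<in> involutions" using class_rep_class[OF k] by simp
  then have "b (class_rep k) \<in> involutions"
    using auto_involutions_iff[OF b] involutions_carrier by blast
  then show ?thesis
    using involution_class_auto[OF a] involutions_carrier[OF r] by (simp add: class_action_def compose_eq)
qed

lemma class_action_inverse:
  assumes a: "a \<in> auto W_D4"
  shows "\<exists>b\<in>auto W_D4. \<forall>k\<in>{1..5}. class_action b (class_action a k) = k"
proof -
  obtain b where b: "b \<in> auto W_D4" "\<forall>x\<in>carrier W_D4. b (a x) = x"
    using W.auto_inverse[OF a] by blast
  have "class_action b (class_action a k) = k" if k: "k \<in> {1..5}" for k
  proof -
    have r: "class_rep k \<in> involutions" "involution_class (class_rep k) = k"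
      using class_rep_class[OF k] by simp_all
    have "class_action b (class_action a k) = class_action (compose (carrier W_D4) b a) k"
      using class_action_compose[OF b(1) a k] by simp
    also have "\<dots> = k"
      using b(2) r involutions_carrier by (simp add: class_action_def compose_eq)
    finally show ?thesis .
  qed
  then show ?thesis using b(1) by blast
qed

lemma class_action_large:
  assumes a: "a \<in> auto W_D4" and k: "k \<in> {4, 5}"
  shows "class_action a k \<in> {4, 5}"
proof (rule ccontr)
  assume "class_action a k \<notin> {4, 5}"
  then have small: "class_action a k \<in> {1..3}" using class_action_range[of a k] by auto
  obtain b where b: "b \<in> auto W_D4" "\<forall>k\<in>{1..5}. class_action b (class_action a k) = k"
    using class_action_inverse[OF a] by blast
  have "class_action b (class_action a k) \<in> {1..3}" using class_action_small[OF b(1) small] .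
  then show False using b(2) k by auto
qed

section \<open>Class-preserving automorphisms are inner\<close>

definition class_preserving :: "(real^4^4 \<Rightarrow> real^4^4) \<Rightarrow> bool" where
  "class_preserving a \<longleftrightarrow> a \<in> auto W_D4 \<and> (\<forall>x\<in>involutions. involution_class (a x) = involution_class x)"

lemma class_preserving_inner_comp:
  assumes a: "class_preserving a" and g: "g \<in> carrier W_D4"
  shows "class_preserving (\<lambda>x\<in>carrier W_D4. g ** a x ** inv\<^bsub>W_D4\<^esub> g)"
proof -
  have "a x \<in> involutions" if "x \<in> involutions" for x
    using a that auto_involutions_iff involutions_carrier by (auto simp: class_preserving_def)
  then show ?thesis
    using a W.inner_comp_auto[of a g] g conj_class involutions_carrier
    by (auto simp: class_preserving_def)
qed

definition pair_type :: "real^4^4 \<Rightarrow> real^4^4 \<Rightarrow> bool \<times> bool \<times> bool \<times> nat" where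
  "pair_type x y = (x = y, (x ** y) ** ((x ** y) ** (x ** y)) = mat 1, x ** y = y ** x,
                    if x ** y \<in> involutions then involution_class (x ** y) else 0)"

definition code_pair_type :: "code \<Rightarrow> code \<Rightarrow> bool \<times> bool \<times> bool \<times> nat" where
  "code_pair_type v w =
     (let vw = code_mult v w in
      (v = w, code_mult vw (code_mult vw vw) = one_code, vw = code_mult w v,
       if code_mult vw vw = one_code \<and> vw \<noteq> one_code \<and> vw \<noteq> neg_code then code_class vw else 0))"

lemma pair_type_code_mat:
  assumes v: "v \<in> set W_codes" and w: "w \<in> set W_codes"
  shows "pair_type (code_mat v) (code_mat w) = code_pair_type v w"
proof -
  let ?vw = "code_mult v w"
  have vw: "?vw \<in> set W_codes" using code_mult_W_codes[OF v w] .
  have invol: "?vw \<in> set involution_codes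
      \<longleftrightarrow> code_mult ?vw ?vw = one_code \<and> ?vw \<noteq> one_code \<and> ?vw \<noteq> neg_code"
    using vw by (simp add: involution_codes_def)
  have "(code_mat v ** code_mat w) ** ((code_mat v ** code_mat w) ** (code_mat v ** code_mat w))
      = code_mat (code_mult ?vw (code_mult ?vw ?vw))"
    using v w vw by (simp add: code_mat_mult_W_codes code_mult_W_codes)
  then show ?thesis
    using v w vw invol special_codes_W_codes(2) code_mult_W_codes[OF vw vw] code_mult_W_codes[OF vw]
      code_mult_W_codes[OF w v]
    by (simp add: pair_type_def code_pair_type_def Let_def code_mat_mult_W_codes code_mat_eq_iff
        code_mat_one_code[symmetric] code_mat_in_involutions involution_class_code_mat)
qed

lemma pair_type_class_preserving:
  assumes a: "class_preserving a" and x: "x \<in> carrier W_D4" and y: "y \<in> carrier W_D4"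
  shows "pair_type (a x) (a y) = pair_type x y"
proof -
  have aut: "a \<in> auto W_D4" using a by (simp add: class_preserving_def)
  interpret a: group_hom W_D4 W_D4 a by (rule W.auto_group_hom[OF aut])
  have inj: "a u = a z \<longleftrightarrow> u = z" if "u \<in> carrier W_D4" "z \<in> carrier W_D4" for u z
    using inj_onD[OF W.auto_inj_on[OF aut]] that by blast
  have xy: "x ** y \<in> carrier W_D4" and yx: "y ** x \<in> carrier W_D4"
    using W.m_closed x y by simp_all
  have hom_xy: "a x ** a y = a (x ** y)" and hom_yx: "a y ** a x = a (y ** x)"
    using a.hom_mult x y by simp_all
  have "(a x ** a y) ** ((a x ** a y) ** (a x ** a y)) = a ((x ** y) ** ((x ** y) ** (x ** y)))"
    using a.hom_mult xy W.m_closed by (simp add: hom_xy)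
  moreover have "(x ** y) ** ((x ** y) ** (x ** y)) \<in> carrier W_D4"
    using W.m_closed xy by simp
  ultimately have cube: "(a x ** a y) ** ((a x ** a y) ** (a x ** a y)) = mat 1
      \<longleftrightarrow> (x ** y) ** ((x ** y) ** (x ** y)) = mat 1"
    using inj W.one_closed a.hom_one by (metis one_W_D4)
  have comm: "a x ** a y = a y ** a x \<longleftrightarrow> x ** y = y ** x"
    using inj xy yx by (simp add: hom_xy hom_yx)
  have invol: "a x ** a y \<in> involutions \<longleftrightarrow> x ** y \<in> involutions"
    using auto_involutions_iff[OF aut xy] by (simp add: hom_xy)
  have "involution_class (a x ** a y) = involution_class (x ** y)" if "x ** y \<in> involutions"
    using a that by (simp add: class_preserving_def hom_xy)
  then show ?thesis
    using inj[OF x y] cube comm invol by (simp add: pair_type_def)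
qed

definition determined_by :: "nat \<Rightarrow> nat list \<Rightarrow> bool" where
  "determined_by i js \<longleftrightarrow>
     list_all (\<lambda>v. code_class v = code_class (gen_codes ! i)
         \<and> list_all (\<lambda>j. code_pair_type v (gen_codes ! j) = code_pair_type (gen_codes ! i) (gen_codes ! j)) js
         \<longrightarrow> v = gen_codes ! i) involution_codes"

definition gen0_witness_codes :: "code list" where
  "gen0_witness_codes = [([1,1,1,1],[3,1,2,0]), ([1,-1,-1,1],[3,1,2,0]), ([1,1,1,1],[3,2,1,0]), ([1,-1,-1,1],[3,2,1,0]), ([1,1,1,1],[0,2,1,3]), ([1,-1,-1,1],[0,2,1,3]), ([1,1,1,1],[0,1,2,3]), ([1,-1,-1,1],[0,1,2,3])]"

lemma gen_codes_involution_codes: "set gen_codes \<subseteq> set involution_codes"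
  by code_simp

lemma gen0_witness_codes_W_codes: "set gen0_witness_codes \<subseteq> set W_codes"
  by code_simp

lemma determined_by_2: "determined_by 2 [1, 0]"
  by code_simp

lemma determined_by_3: "determined_by 3 [1, 0, 2]"
  by code_simp

lemma gen0_witnesses:
  "list_all (\<lambda>v. code_class v = code_class (gen_codes ! 0)
       \<and> code_pair_type v (gen_codes ! 1) = code_pair_type (gen_codes ! 0) (gen_codes ! 1)
       \<longrightarrow> list_ex (\<lambda>g. code_mult g (gen_codes ! 1) = code_mult (gen_codes ! 1) g
                        \<and> code_mult g v = code_mult (gen_codes ! 0) g) gen0_witness_codes)
     involution_codes"
  by code_simp

lemma gen_involutions: "i < 4 \<Longrightarrow> gen i \<in> involutions"
  using gen_codes_involution_codes gen_codes_nth by (auto simp: gen_def involutions_codes)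

lemma class_preserving_gen_image:
  assumes a: "class_preserving a" and i: "i < 4"
  shows "\<exists>v\<in>set involution_codes. a (gen i) = code_mat v \<and> code_class v = code_class (gen_codes ! i)"
proof -
  have g: "gen i \<in> involutions" by (rule gen_involutions[OF i])
  then have "a (gen i) \<in> involutions" and same: "involution_class (a (gen i)) = involution_class (gen i)"
    using a auto_involutions_iff involutions_carrier by (auto simp: class_preserving_def)
  then obtain v where v: "v \<in> set involution_codes" "a (gen i) = code_mat v"
    by (auto simp: involutions_codes)
  have "code_class v = code_class (gen_codes ! i)"
    using same v gen_codes_W_codes[OF i]
    by (simp add: gen_def involution_class_code_mat involution_codes_W_codes)
  then show ?thesis using v by blast
qed

lemma code_pair_type_image:
  assumes a: "class_preserving a" and i: "i < 4" and j: "j < 4" and fix_j: "a (gen j) = gen j"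
    and v: "v \<in> set W_codes" and img: "a (gen i) = code_mat v"
  shows "code_pair_type v (gen_codes ! j) = code_pair_type (gen_codes ! i) (gen_codes ! j)"
proof -
  have "code_pair_type v (gen_codes ! j) = pair_type (a (gen i)) (a (gen j))"
    using v gen_codes_W_codes[OF j] img fix_j by (simp add: pair_type_code_mat gen_def)
  also have "\<dots> = pair_type (gen i) (gen j)"
    using pair_type_class_preserving[OF a gen_carrier[OF i] gen_carrier[OF j]] .
  also have "\<dots> = code_pair_type (gen_codes ! i) (gen_codes ! j)"
    using gen_codes_W_codes i j by (simp add: pair_type_code_mat gen_def)
  finally show ?thesis .
qed

lemma fixed_if_determined:
  assumes a: "class_preserving a" and i: "i < 4" and det: "determined_by i js"
    and fixed: "\<And>j. j \<in> set js \<Longrightarrow> j < 4 \<and> a (gen j) = gen j"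
  shows "a (gen i) = gen i"
proof -
  obtain v where v: "v \<in> set involution_codes" "a (gen i) = code_mat v"
    and cls: "code_class v = code_class (gen_codes ! i)"
    using class_preserving_gen_image[OF a i] by blast
  have "code_pair_type v (gen_codes ! j) = code_pair_type (gen_codes ! i) (gen_codes ! j)"
    if "j \<in> set js" for j
    using code_pair_type_image[OF a i _ _ involution_codes_W_codes[OF v(1)] v(2)] fixed[OF that] by blast
  then have "v = gen_codes ! i"
    using det v(1) cls by (auto simp: determined_by_def list_all_iff)
  then show ?thesis using v(2) by (simp add: gen_def)
qed

lemma conj_fixing_gen1:
  assumes a: "class_preserving a"
  shows "\<exists>g\<in>carrier W_D4. g ** a (gen 1) ** inv\<^bsub>W_D4\<^esub> g = gen 1"
proof -
  have g1: "gen 1 \<in> involutions" by (rule gen_involutions) simp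
  then have "a (gen 1) \<in> involutions" "involution_class (a (gen 1)) = involution_class (gen 1)"
    using a auto_involutions_iff involutions_carrier by (auto simp: class_preserving_def)
  then have "conjugate W_D4 (a (gen 1)) (gen 1)" using conjugate_iff_same_class g1 by blast
  then show ?thesis by (simp add: conjugate_def)
qed

lemma conj_fixing_gen0:
  assumes a: "class_preserving a" and fix1: "a (gen 1) = gen 1"
  shows "\<exists>g\<in>carrier W_D4. g ** gen 1 ** inv\<^bsub>W_D4\<^esub> g = gen 1 \<and> g ** a (gen 0) ** inv\<^bsub>W_D4\<^esub> g = gen 0"
proof -
  obtain v where v: "v \<in> set involution_codes" "a (gen 0) = code_mat v"
    and cls: "code_class v = code_class (gen_codes ! 0)"
    using class_preserving_gen_image[OF a, of 0] by auto
  have vW: "v \<in> set W_codes" using v(1) by (rule involution_codes_W_codes)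
  have "code_pair_type v (gen_codes ! 1) = code_pair_type (gen_codes ! 0) (gen_codes ! 1)"
    using code_pair_type_image[OF a _ _ fix1 vW v(2)] by simp
  then obtain g where g0: "g \<in> set gen0_witness_codes"
    and c1: "code_mult g (gen_codes ! 1) = code_mult (gen_codes ! 1) g"
    and c0: "code_mult g v = code_mult (gen_codes ! 0) g"
    using gen0_witnesses v(1) cls by (auto simp: list_all_iff list_ex_iff)
  have gW: "g \<in> set W_codes" using g0 gen0_witness_codes_W_codes by blast
  have g: "code_mat g \<in> carrier W_D4" using code_mat_in_carrier[OF gW] .
  have "code_mat g ** gen 1 = gen 1 ** code_mat g"
    using c1 gW gen_codes_W_codes[of 1] by (simp add: gen_def code_mat_mult_W_codes)
  then have "code_mat g ** gen 1 ** inv\<^bsub>W_D4\<^esub> (code_mat g) = gen 1"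
    using W.conjugate_if_commute[OF g gen_carrier gen_carrier, of 1 1] by simp
  moreover have "code_mat g ** a (gen 0) = gen 0 ** code_mat g"
    unfolding v(2) using c0 gW vW gen_codes_W_codes[of 0] by (simp add: gen_def code_mat_mult_W_codes)
  then have "code_mat g ** a (gen 0) ** inv\<^bsub>W_D4\<^esub> (code_mat g) = gen 0"
    using W.conjugate_if_commute[OF g _ gen_carrier, of "a (gen 0)" 0] code_mat_in_carrier[OF vW] v(2)
    by simp
  ultimately show ?thesis using g by blast
qed

lemma Inn_if_fixes_gens:
  assumes a: "a \<in> auto W_D4" and fixed: "\<And>i. i < 4 \<Longrightarrow> a (gen i) = gen i"
  shows "a \<in> Inn W_D4"
proof -
  interpret a: group_hom W_D4 W_D4 a by (rule W.auto_group_hom[OF a])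
  have "a x = x" if "x \<in> carrier W_D4" for x
    using that
  proof (induction x rule: gen_induct)
    case one
    then show ?case using a.hom_one by simp
  next
    case (step y i)
    then show ?case
      using a.hom_mult[OF \<open>y \<in> carrier W_D4\<close> gen_carrier[OF \<open>i < 4\<close>]] fixed by simp
  qed
  moreover have "a \<in> extensional (carrier W_D4)" using a by (simp add: auto_def Bij_def)
  moreover have "inv\<^bsub>W_D4\<^esub> (mat 1) = mat 1" using W.inv_one by simp
  ultimately have "a = (\<lambda>x\<in>carrier W_D4. mat 1 ** x ** inv\<^bsub>W_D4\<^esub> (mat 1))"
    by (auto simp: extensional_def)
  moreover have "mat 1 \<in> carrier W_D4" using W.one_closed by simp
  ultimately show ?thesis unfolding Inn_def mult_W_D4 by blast
qed

text \<open>After conjugation, a class-preserving automorphism fixes the branch generator \<open>gen 1\<close>, and,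
  by a second conjugation inside its centraliser, also \<open>gen 0\<close>; the relations with the fixed
  generators then leave no choice for the images of \<open>gen 2\<close> and \<open>gen 3\<close>.\<close>

lemma class_preserving_Inn:
  assumes a: "class_preserving a"
  shows "a \<in> Inn W_D4"
proof -
  obtain g1 where g1: "g1 \<in> carrier W_D4" "g1 ** a (gen 1) ** inv\<^bsub>W_D4\<^esub> g1 = gen 1"
    using conj_fixing_gen1[OF a] by blast
  define a1 where "a1 = (\<lambda>x\<in>carrier W_D4. g1 ** a x ** inv\<^bsub>W_D4\<^esub> g1)"
  have a1: "class_preserving a1" "a1 (gen 1) = gen 1"
    using class_preserving_inner_comp[OF a g1(1)] g1(2) gen_carrier by (simp_all add: a1_def)
  obtain g2 where g2: "g2 \<in> carrier W_D4" "g2 ** gen 1 ** inv\<^bsub>W_D4\<^esub> g2 = gen 1"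
      "g2 ** a1 (gen 0) ** inv\<^bsub>W_D4\<^esub> g2 = gen 0"
    using conj_fixing_gen0[OF a1] by blast
  define a2 where "a2 = (\<lambda>x\<in>carrier W_D4. g2 ** a1 x ** inv\<^bsub>W_D4\<^esub> g2)"
  have a2: "class_preserving a2" "a2 (gen 1) = gen 1" "a2 (gen 0) = gen 0"
    using class_preserving_inner_comp[OF a1(1) g2(1)] g2 a1(2) gen_carrier by (simp_all add: a2_def)
  have "a2 (gen 2) = gen 2"
    by (rule fixed_if_determined[OF a2(1) _ determined_by_2]) (use a2 in auto)
  moreover have "a2 (gen 3) = gen 3"
    by (rule fixed_if_determined[OF a2(1) _ determined_by_3]) (use a2 \<open>a2 (gen 2) = gen 2\<close> in auto)
  ultimately have "a2 \<in> Inn W_D4"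
    using Inn_if_fixes_gens a2 by (metis class_preserving_def less_4_cases)
  then have "a1 \<in> Inn W_D4"
    using W.Inn_if_inner_comp g2(1) a1(1) by (simp add: a2_def class_preserving_def)
  then show ?thesis
    using W.Inn_if_inner_comp g1(1) a by (simp add: a1_def class_preserving_def)
qed

section \<open>The homomorphism onto S3 \<times> Z/2\<close>

lemma AutoGroup_carrier: "carrier (AutoGroup W_D4) = auto W_D4"
  by (simp add: AutoGroup_def BijGroup_def)

lemma AutoGroup_mult:
  "a \<in> auto W_D4 \<Longrightarrow> b \<in> auto W_D4 \<Longrightarrow> a \<otimes>\<^bsub>AutoGroup W_D4\<^esub> b = compose (carrier W_D4) a b"
  by (simp add: AutoGroup_def BijGroup_def auto_def)

abbreviation S3_x_Z2 :: "((nat \<Rightarrow> nat) \<times> int) monoid" where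
  "S3_x_Z2 \<equiv> DirProd (sym_group 3) (integer_mod_group 2)"

text \<open>The permutation of the three classes of size 6, and whether the two classes of size 12
  are exchanged.\<close>

definition outer_invariant :: "(real^4^4 \<Rightarrow> real^4^4) \<Rightarrow> (nat \<Rightarrow> nat) \<times> int" where
  "outer_invariant a =
     ((\<lambda>k. if k \<in> {1..3} then class_action a k else k), if class_action a 4 = 4 then 0 else 1)"

lemma outer_invariant_carrier:
  assumes a: "a \<in> auto W_D4"
  shows "outer_invariant a \<in> carrier S3_x_Z2"
proof -
  let ?p = "\<lambda>k. if k \<in> {1..3} then class_action a k else k"
  obtain b where b: "\<forall>k\<in>{1..5}. class_action b (class_action a k) = k"
    using class_action_inverse[OF a] by blast
  have "inj_on ?p {1..3}"
  proof (rule inj_onI)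
    fix k l assume k: "k \<in> {1..3}" and l: "l \<in> {1..3}" and eq: "?p k = ?p l"
    then have "class_action b (class_action a k) = class_action b (class_action a l)" by simp
    moreover have "k \<in> {1..5}" "l \<in> {1..5}" using k l by auto
    ultimately show "k = l" using b by simp
  qed
  moreover have "?p ` {1..3} \<subseteq> {1..3}" using class_action_small[OF a] by auto
  ultimately have "bij_betw ?p {1..3} {1..3}"
    unfolding bij_betw_def using endo_inj_surj[of "{1..3}" ?p] by blast
  then have "?p permutes {1..3}" by (rule bij_imp_permutes) auto
  then show ?thesis
    by (simp add: outer_invariant_def sym_group_carrier carrier_integer_mod_group)
qed

lemma outer_invariant_compose:
  assumes a: "a \<in> auto W_D4" and b: "b \<in> auto W_D4"
  shows "outer_invariant (compose (carrier W_D4) a b)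
       = (fst (outer_invariant a) \<circ> fst (outer_invariant b),
          (snd (outer_invariant a) + snd (outer_invariant b)) mod 2)"
proof -
  let ?ab = "compose (carrier W_D4) a b"
  have comp: "class_action ?ab k = class_action a (class_action b k)" if "k \<in> {1..5}" for k
    using class_action_compose[OF a b that] .
  have "fst (outer_invariant ?ab) k = (fst (outer_invariant a) \<circ> fst (outer_invariant b)) k" for k
  proof (cases "k \<in> {1..3}")
    case True
    then have "class_action b k \<in> {1..3}" by (rule class_action_small[OF b])
    moreover have "k \<in> {1..5}" using True by auto
    ultimately show ?thesis using True comp[OF \<open>k \<in> {1..5}\<close>] by (auto simp: outer_invariant_def)
  next
    case False
    then show ?thesis by (auto simp: outer_invariant_def)
  qed
  moreover have "snd (outer_invariant ?ab) = (snd (outer_invariant a) + snd (outer_invariant b)) mod 2"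
  proof -
    have a4: "class_action a 4 = 4 \<or> class_action a 4 = 5" using class_action_large[OF a] by simp
    have a5: "class_action a 5 = Transposition.transpose 4 5 (class_action a 4)"
      using class_action_transpose45[OF a, of 4] by simp
    have "class_action b 4 = 4 \<or> class_action b 4 = 5" using class_action_large[OF b] by simp
    then show ?thesis
    proof
      assume "class_action b 4 = 4"
      then show ?thesis using comp[of 4] a4 by (auto simp: outer_invariant_def)
    next
      assume "class_action b 4 = 5"
      then show ?thesis using comp[of 4] a4 a5 by (auto simp: outer_invariant_def Transposition.transpose_def)
    qed
  qed
  ultimately show ?thesis by (simp add: prod_eq_iff fun_eq_iff)
qed

lemma outer_invariant_hom: "outer_invariant \<in> hom (AutoGroup W_D4) S3_x_Z2"
proof (rule homI)
  fix a assume "a \<in> carrier (AutoGroup W_D4)"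
  then show "outer_invariant a \<in> carrier S3_x_Z2"
    by (intro outer_invariant_carrier) (simp add: AutoGroup_carrier)
next
  fix a b assume "a \<in> carrier (AutoGroup W_D4)" "b \<in> carrier (AutoGroup W_D4)"
  then have a: "a \<in> auto W_D4" and b: "b \<in> auto W_D4" by (simp_all add: AutoGroup_carrier)
  show "outer_invariant (a \<otimes>\<^bsub>AutoGroup W_D4\<^esub> b) = outer_invariant a \<otimes>\<^bsub>S3_x_Z2\<^esub> outer_invariant b"
    using outer_invariant_compose[OF a b] by (simp add: AutoGroup_mult[OF a b] mult_DirProd' sym_group_mult)
qed

lemma outer_invariant_inner:
  assumes g: "g \<in> carrier W_D4"
  shows "outer_invariant (\<lambda>x\<in>carrier W_D4. g ** x ** inv\<^bsub>W_D4\<^esub> g) = (id, 0)"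
proof -
  have "class_action (\<lambda>x\<in>carrier W_D4. g ** x ** inv\<^bsub>W_D4\<^esub> g) k = k" if "k \<in> {1..5}" for k
    using class_rep_class[OF that] conj_class[OF g] involutions_carrier by (simp add: class_action_def)
  then show ?thesis by (simp add: outer_invariant_def fun_eq_iff)
qed

lemma class_preserving_if_outer_trivial:
  assumes a: "a \<in> auto W_D4" and triv: "outer_invariant a = (id, 0)"
  shows "class_preserving a"
proof -
  have small: "class_action a k = k" if "k \<in> {1..3}" for k
    using triv that by (auto simp: outer_invariant_def fun_eq_iff split: if_splits)
  have four: "class_action a 4 = 4"
    using triv by (auto simp: outer_invariant_def split: if_splits)
  have "class_action a 5 = 5"
    using class_action_transpose45[OF a, of 4] four by simp
  moreover have "k \<in> {1..3} \<or> k = 4 \<or> k = 5" if "k \<in> {1..5}" for k :: nat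
    using that by auto
  ultimately have "class_action a k = k" if "k \<in> {1..5}" for k
    using that small four by blast
  then show ?thesis
    using a involution_class_auto involution_class_range by (simp add: class_preserving_def)
qed

lemma kernel_outer_invariant: "kernel (AutoGroup W_D4) S3_x_Z2 outer_invariant = Inn W_D4"
proof
  show "kernel (AutoGroup W_D4) S3_x_Z2 outer_invariant \<subseteq> Inn W_D4"
    using class_preserving_if_outer_trivial class_preserving_Inn
    by (auto simp: kernel_def AutoGroup_carrier sym_group_one)
  show "Inn W_D4 \<subseteq> kernel (AutoGroup W_D4) S3_x_Z2 outer_invariant"
    using W.inner_in_auto outer_invariant_inner
    by (auto simp: kernel_def AutoGroup_carrier sym_group_one Inn_def)
qed

section \<open>Surjectivity\<close>

lemma conj_involutive_mult:
  assumes "h ** h = mat 1"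
  shows "h ** (x ** y) ** h = (h ** x ** h) ** (h ** y ** h)"
proof -
  have "(h ** x ** h) ** (h ** y ** h) = h ** x ** (h ** h) ** y ** h"
    by (simp only: matrix_mul_assoc)
  then show ?thesis by (simp add: assms matrix_mul_assoc)
qed

definition normalizer_conj :: "real^4^4 \<Rightarrow> real^4^4 \<Rightarrow> real^4^4" where
  "normalizer_conj h = (\<lambda>x\<in>carrier W_D4. h ** x ** h)"

lemma normalizer_conj_auto:
  assumes hh: "h ** h = mat 1" and hg: "\<And>i. i < 4 \<Longrightarrow> h ** gen i ** h \<in> carrier W_D4"
  shows "normalizer_conj h \<in> auto W_D4"
proof -
  have invol: "h ** (h ** x ** h) ** h = x" for x
  proof -
    have "h ** (h ** x ** h) ** h = (h ** h) ** x ** (h ** h)" by (simp only: matrix_mul_assoc)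
    then show ?thesis by (simp add: hh)
  qed
  have closed: "h ** x ** h \<in> carrier W_D4" if "x \<in> carrier W_D4" for x
    using that
  proof (induction x rule: gen_induct)
    case one
    then show ?case using hh W.one_closed by simp
  next
    case (step y i)
    then show ?case
      using conj_involutive_mult[OF hh, of y "gen i"] W_D4_mult_closed[OF step.IH hg[OF \<open>i < 4\<close>]] by simp
  qed
  have "normalizer_conj h \<in> hom W_D4 W_D4"
    by (rule homI) (simp_all add: normalizer_conj_def closed W_D4_mult_closed conj_involutive_mult[OF hh])
  moreover have "bij_betw (normalizer_conj h) (carrier W_D4) (carrier W_D4)"
    by (rule bij_betw_byWitness[where f' = "normalizer_conj h"])
      (auto simp: normalizer_conj_def closed invol)
  ultimately show ?thesis by (simp add: auto_def Bij_def normalizer_conj_def)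
qed

text \<open>The reflections in the root \<open>(1, -1, -1, -1)/2\<close> of F4 and in the basis vector \<open>e\<^sub>4\<close>.
  Both normalise W(D4); conjugation by them permutes the Coxeter generators and realises the
  two transpositions of the triality group.\<close>

definition refl_half :: "real^4^4" where
  "refl_half = (\<chi> i j. if i = 1 \<or> j = 1 \<or> i = j then 1/2 else -1/2)"

definition refl_e4 :: "real^4^4" where
  "refl_e4 = (\<chi> i j. if i = j then (if i = 4 then -1 else 1) else 0)"

lemma refl_half_involutive: "refl_half ** refl_half = mat 1"
  and refl_e4_involutive: "refl_e4 ** refl_e4 = mat 1"
  unfolding vec_eq_iff forall_4
  by (simp_all add: matrix_matrix_mult_def sum_4 refl_half_def refl_e4_def mat_def)

lemma gen_entry:
  "gen i $ a $ b =
     (if index4 a = snd (gen_codes ! i) ! index4 b then real_of_int (fst (gen_codes ! i) ! index4 b) else 0)"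
  by (simp add: gen_def code_mat_entry)

lemma refl_half_gen:
  "refl_half ** gen 0 ** refl_half = gen 3" "refl_half ** gen 1 ** refl_half = gen 1"
  "refl_half ** gen 2 ** refl_half = gen 2" "refl_half ** gen 3 ** refl_half = gen 0"
  unfolding vec_eq_iff forall_4
  by (simp_all add: matrix_matrix_mult_def sum_4 refl_half_def gen_entry gen_codes_def index4_def)

lemma refl_e4_gen:
  "refl_e4 ** gen 0 ** refl_e4 = gen 0" "refl_e4 ** gen 1 ** refl_e4 = gen 1"
  "refl_e4 ** gen 2 ** refl_e4 = gen 3" "refl_e4 ** gen 3 ** refl_e4 = gen 2"
  unfolding vec_eq_iff forall_4
  by (simp_all add: matrix_matrix_mult_def sum_4 refl_e4_def gen_entry gen_codes_def index4_def)

lemma refl_half_auto: "normalizer_conj refl_half \<in> auto W_D4"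
proof (rule normalizer_conj_auto[OF refl_half_involutive])
  fix i :: nat assume "i < 4"
  then consider "i = 0" | "i = 1" | "i = 2" | "i = 3" by linarith
  then show "refl_half ** gen i ** refl_half \<in> carrier W_D4"
    by cases (simp_all add: refl_half_gen[simplified] gen_carrier)
qed

lemma refl_e4_auto: "normalizer_conj refl_e4 \<in> auto W_D4"
proof (rule normalizer_conj_auto[OF refl_e4_involutive])
  fix i :: nat assume "i < 4"
  then consider "i = 0" | "i = 1" | "i = 2" | "i = 3" by linarith
  then show "refl_e4 ** gen i ** refl_e4 \<in> carrier W_D4"
    by cases (simp_all add: refl_e4_gen[simplified] gen_carrier)
qed

lemma class_rep_gens:
  "class_rep 1 = gen 2 ** gen 3" "class_rep 2 = gen 0 ** gen 2" "class_rep 3 = gen 0 ** gen 3"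
  "class_rep 4 = gen 0"
  using gen_codes_W_codes by (simp_all add: class_rep_def class_rep_code_def gen_def code_mat_mult_W_codes)

lemma gen_code_classes:
  "code_class (code_mult (gen_codes ! 2) (gen_codes ! 0)) = 2
   \<and> code_class (code_mult (gen_codes ! 3) (gen_codes ! 2)) = 1
   \<and> code_class (code_mult (gen_codes ! 3) (gen_codes ! 0)) = 3
   \<and> code_class (code_mult (gen_codes ! 0) (gen_codes ! 3)) = 3
   \<and> code_class (code_mult (gen_codes ! 0) (gen_codes ! 2)) = 2
   \<and> code_class (gen_codes ! 3) = 4
   \<and> code_class (gen_codes ! 0) = 4"
  by code_simp

lemma gen_classes:
  "involution_class (gen 2 ** gen 0) = 2" "involution_class (gen 3 ** gen 2) = 1" "involution_class (gen 3 ** gen 0) = 3"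
  "involution_class (gen 0 ** gen 3) = 3" "involution_class (gen 0 ** gen 2) = 2" "involution_class (gen 3) = 4"
  "involution_class (gen 0) = 4"
  using gen_code_classes gen_codes_W_codes code_mult_W_codes
  by (simp_all add: gen_def code_mat_mult_W_codes involution_class_code_mat)

lemma class_rep_carrier: "k \<in> {1..5} \<Longrightarrow> class_rep k \<in> carrier W_D4"
  using class_rep_class involutions_carrier by blast

lemma outer_invariant_refl_half: "outer_invariant (normalizer_conj refl_half) = (Transposition.transpose 1 2, 0)"
proof -
  have img: "refl_half ** class_rep 1 ** refl_half = gen 2 ** gen 0" "refl_half ** class_rep 2 ** refl_half = gen 3 ** gen 2"
    "refl_half ** class_rep 3 ** refl_half = gen 3 ** gen 0" "refl_half ** class_rep 4 ** refl_half = gen 3"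
    by (simp_all only: class_rep_gens conj_involutive_mult[OF refl_half_involutive] refl_half_gen)
  have "class_action (normalizer_conj refl_half) k = involution_class (refl_half ** class_rep k ** refl_half)"
    if "k \<in> {1..5}" for k
    using class_rep_carrier[OF that] by (simp add: class_action_def normalizer_conj_def)
  then have vals: "class_action (normalizer_conj refl_half) 1 = 2" "class_action (normalizer_conj refl_half) 2 = 1"
    "class_action (normalizer_conj refl_half) 3 = 3" "class_action (normalizer_conj refl_half) 4 = 4"
    using img gen_classes by simp_all
  have "(\<lambda>k. if k \<in> {1..3} then class_action (normalizer_conj refl_half) k else k)
      = Transposition.transpose 1 2"
  proof
    fix k :: nat
    show "(if k \<in> {1..3} then class_action (normalizer_conj refl_half) k else k) = Transposition.transpose 1 2 k"
      using vals by (cases "k = 1"; cases "k = 2"; cases "k = 3") (simp_all add: Transposition.transpose_def)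
  qed
  with vals(4) show ?thesis
    by (simp add: outer_invariant_def)
qed

lemma outer_invariant_refl_e4: "outer_invariant (normalizer_conj refl_e4) = (Transposition.transpose 2 3, 0)"
proof -
  have img: "refl_e4 ** class_rep 1 ** refl_e4 = gen 3 ** gen 2" "refl_e4 ** class_rep 2 ** refl_e4 = gen 0 ** gen 3"
    "refl_e4 ** class_rep 3 ** refl_e4 = gen 0 ** gen 2" "refl_e4 ** class_rep 4 ** refl_e4 = gen 0"
    by (simp_all only: class_rep_gens conj_involutive_mult[OF refl_e4_involutive] refl_e4_gen)
  have "class_action (normalizer_conj refl_e4) k = involution_class (refl_e4 ** class_rep k ** refl_e4)"
    if "k \<in> {1..5}" for k
    using class_rep_carrier[OF that] by (simp add: class_action_def normalizer_conj_def)
  then have vals: "class_action (normalizer_conj refl_e4) 1 = 1" "class_action (normalizer_conj refl_e4) 2 = 3"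
    "class_action (normalizer_conj refl_e4) 3 = 2" "class_action (normalizer_conj refl_e4) 4 = 4"
    using img gen_classes by simp_all
  have "(\<lambda>k. if k \<in> {1..3} then class_action (normalizer_conj refl_e4) k else k)
      = Transposition.transpose 2 3"
  proof
    fix k :: nat
    show "(if k \<in> {1..3} then class_action (normalizer_conj refl_e4) k else k) = Transposition.transpose 2 3 k"
      using vals by (cases "k = 1"; cases "k = 2"; cases "k = 3") (simp_all add: Transposition.transpose_def)
  qed
  with vals(4) show ?thesis
    by (simp add: outer_invariant_def)
qed

lemma det_signed_perm_mat:
  assumes "even_signs_perm e p"
  shows "det (signed_perm_mat e p) = of_int (sign p)"
proof -
  have p: "p permutes (UNIV :: 4 set)" and e: "(\<Prod>i\<in>UNIV. e i) = 1"
    using assms by (auto simp: even_signs_perm_def)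
  have "det (diag_mat e) = (\<Prod>i\<in>UNIV. diag_mat e $ i $ i)"
    by (rule det_diagonal) (simp add: diag_mat_def)
  also have "\<dots> = 1" using e by (simp add: diag_mat_def)
  finally have diag: "det (diag_mat e) = 1" .
  have "perm_mat p = (\<chi> i. (mat 1 :: real^4^4) $ inv' p i)"
  proof -
    have "i = p j \<longleftrightarrow> inv' p i = j" for i j
      using permutes_inverses[OF p] by metis
    then show ?thesis by (simp add: vec_eq_iff perm_mat_def mat_def)
  qed
  then have "det (perm_mat p) = of_int (sign (inv' p))"
    using det_permute_rows[OF permutes_inv[OF p], of "mat 1 :: real^4^4"] by simp
  also have "\<dots> = of_int (sign p)"
    using sign_inverse permutation_permutes p by (metis finite_class.finite_UNIV)
  finally show ?thesis using diag by (simp add: signed_perm_mat_def det_mul)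
qed

lemma det_W_D4: "x \<in> carrier W_D4 \<Longrightarrow> det x = 1 \<or> det x = -1"
  by (auto simp: carrier_W_D4 det_signed_perm_mat sign_def split: if_splits)

lemma det_gen0: "det (gen 0) = -1"
proof -
  have "gen 0 = signed_perm_mat (\<lambda>_. 1) (Transposition.transpose 1 2)"
    unfolding vec_eq_iff forall_4
    by (simp add: gen_entry gen_codes_def index4_def signed_perm_mat_entry Transposition.transpose_def)
  moreover have "even_signs_perm (\<lambda>_. 1) (Transposition.transpose (1::4) 2)"
    by (simp add: even_signs_perm_def permutes_swap_id)
  ultimately show ?thesis by (simp add: det_signed_perm_mat sign_swap_id)
qed

lemma neg_one_mult: "neg_one ** x = - x"
  unfolding neg_one_def scalar_matrix_assoc[symmetric] by simp

lemma det_neg_one: "det neg_one = 1"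
proof -
  have "det neg_one = (\<Prod>i\<in>UNIV. neg_one $ i $ i)"
    by (rule det_diagonal) (simp add: neg_one_def mat_def)
  then show ?thesis by (simp add: neg_one_def mat_def)
qed

definition det_twist :: "real^4^4 \<Rightarrow> real^4^4" where
  "det_twist = (\<lambda>x\<in>carrier W_D4. det x *\<^sub>R x)"

lemma det_twist_eq:
  assumes "x \<in> carrier W_D4"
  shows "det_twist x = (if det x = 1 then x else neg_one ** x)"
  using det_W_D4[OF assms] assms by (auto simp: det_twist_def neg_one_mult)

lemma det_twist_auto: "det_twist \<in> auto W_D4"
proof -
  have closed: "det_twist x \<in> carrier W_D4" if "x \<in> carrier W_D4" for x
    using that det_twist_eq W_D4_mult_closed[OF neg_one_carrier that] by simp
  have "det_twist \<in> hom W_D4 W_D4"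
  proof (rule homI)
    fix x y assume x: "x \<in> carrier W_D4" and y: "y \<in> carrier W_D4"
    have "det_twist (x ** y) = (det x * det y) *\<^sub>R (x ** y)"
      using W_D4_mult_closed[OF x y] by (simp add: det_twist_def det_mul)
    also have "\<dots> = (det x *\<^sub>R x) ** (det y *\<^sub>R y)"
      by (simp add: matrix_scalar_ac scalar_matrix_assoc[symmetric])
    finally show "det_twist (x \<otimes>\<^bsub>W_D4\<^esub> y) = det_twist x \<otimes>\<^bsub>W_D4\<^esub> det_twist y"
      using x y by (simp add: det_twist_def)
  qed (simp add: closed)
  moreover have "det_twist (det_twist x) = x" if x: "x \<in> carrier W_D4" for x
  proof (cases "det x = 1")
    case False
    then have "det (neg_one ** x) = -1" using det_W_D4[OF x] by (simp add: det_mul det_neg_one)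
    then show ?thesis
      using False x det_twist_eq W_D4_mult_closed[OF neg_one_carrier x]
      by (simp add: neg_one_mult)
  qed (simp add: det_twist_eq x)
  then have "bij_betw det_twist (carrier W_D4) (carrier W_D4)"
    by (intro bij_betw_byWitness[where f' = det_twist]) (auto simp: closed)
  ultimately show ?thesis by (simp add: auto_def Bij_def det_twist_def)
qed

lemma outer_invariant_det_twist: "outer_invariant det_twist = (id, 1)"
proof -
  have "class_action det_twist k = k" if k: "k \<in> {1..3}" for k
  proof -
    have r: "class_rep k \<in> involutions" "involution_class (class_rep k) = k"
      using class_rep_class k by auto
    have "Transposition.transpose 4 5 k = k" using k by (auto simp: Transposition.transpose_def)
    then show ?thesis
      using neg_one_class[OF r(1)] r involutions_carrier det_twist_eq by (simp add: class_action_def)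
  qed
  moreover have "class_action det_twist 4 = 5"
  proof -
    have "det_twist (class_rep 4) = neg_one ** gen 0"
      using det_twist_eq[OF gen_carrier[of 0]] det_gen0 by (simp add: class_rep_gens)
    then show ?thesis
      using neg_one_class[OF gen_involutions[of 0]] gen_classes(7)
      by (simp add: class_action_def Transposition.transpose_def)
  qed
  ultimately show ?thesis by (simp add: outer_invariant_def fun_eq_iff)
qed

lemma permutes_3_eq:
  assumes "p permutes {1..3::nat}" "q permutes {1..3::nat}" "p 1 = q 1" "p 2 = q 2" "p 3 = q 3"
  shows "p = q"
proof
  fix n
  show "p n = q n"
  proof (cases "n \<in> {1..3}")
    case True
    then have "n = 1 \<or> n = 2 \<or> n = 3" by auto
    then show ?thesis using assms by auto
  qed (metis assms(1,2) permutes_not_in)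
qed

abbreviation t12 :: "nat \<Rightarrow> nat" where "t12 \<equiv> Transposition.transpose 1 2"
abbreviation t23 :: "nat \<Rightarrow> nat" where "t23 \<equiv> Transposition.transpose 2 3"

lemma distinct_123_cases:
  assumes "(x::nat) \<in> {1, 2, 3}" "y \<in> {1, 2, 3}" "z \<in> {1, 2, 3}" "x \<noteq> y" "x \<noteq> z" "y \<noteq> z"
  shows "(x = 1 \<and> y = 2 \<and> z = 3) \<or> (x = 2 \<and> y = 1 \<and> z = 3) \<or> (x = 1 \<and> y = 3 \<and> z = 2)
    \<or> (x = 2 \<and> y = 3 \<and> z = 1) \<or> (x = 3 \<and> y = 1 \<and> z = 2) \<or> (x = 3 \<and> y = 2 \<and> z = 1)"
  using assms by auto

lemma permutes_3_cases:
  assumes p: "p permutes {1..3::nat}"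
  shows "p \<in> {id, t12, t23, t12 \<circ> t23, t23 \<circ> t12, t12 \<circ> t23 \<circ> t12}"
proof -
  have t: "t12 permutes {1..3}" "t23 permutes {1..3}" by (auto intro: permutes_swap_id)
  have "{1..3::nat} = {1, 2, 3}" by auto
  then have range: "p 1 \<in> {1, 2, 3}" "p 2 \<in> {1, 2, 3}" "p 3 \<in> {1, 2, 3}"
    using permutes_in_image[OF p] by simp_all
  have distinct: "p 1 \<noteq> p 2" "p 1 \<noteq> p 3" "p 2 \<noteq> p 3"
    using permutes_inj[OF p] by (simp_all add: inj_eq)
  have "(p 1 = 1 \<and> p 2 = 2 \<and> p 3 = 3) \<or> (p 1 = 2 \<and> p 2 = 1 \<and> p 3 = 3)
      \<or> (p 1 = 1 \<and> p 2 = 3 \<and> p 3 = 2) \<or> (p 1 = 2 \<and> p 2 = 3 \<and> p 3 = 1)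
      \<or> (p 1 = 3 \<and> p 2 = 1 \<and> p 3 = 2) \<or> (p 1 = 3 \<and> p 2 = 2 \<and> p 3 = 1)"
    by (rule distinct_123_cases[OF range distinct])
  then show ?thesis
  proof (elim disjE conjE)
    assume "p 1 = 1" "p 2 = 2" "p 3 = 3"
    then have "p = id" by (intro permutes_3_eq[OF p permutes_id]) simp_all
    then show ?thesis by blast
  next
    assume "p 1 = 2" "p 2 = 1" "p 3 = 3"
    then have "p = t12" by (intro permutes_3_eq[OF p t(1)]) (simp_all add: Transposition.transpose_def)
    then show ?thesis by blast
  next
    assume "p 1 = 1" "p 2 = 3" "p 3 = 2"
    then have "p = t23" by (intro permutes_3_eq[OF p t(2)]) (simp_all add: Transposition.transpose_def)
    then show ?thesis by blast
  next
    assume "p 1 = 2" "p 2 = 3" "p 3 = 1"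
    then have "p = t12 \<circ> t23"
      by (intro permutes_3_eq[OF p permutes_compose[OF t(2,1)]]) (simp_all add: Transposition.transpose_def)
    then show ?thesis by blast
  next
    assume "p 1 = 3" "p 2 = 1" "p 3 = 2"
    then have "p = t23 \<circ> t12"
      by (intro permutes_3_eq[OF p permutes_compose[OF t(1,2)]]) (simp_all add: Transposition.transpose_def)
    then show ?thesis by blast
  next
    assume "p 1 = 3" "p 2 = 2" "p 3 = 1"
    then have "p = t12 \<circ> t23 \<circ> t12"
      by (intro permutes_3_eq[OF p permutes_compose[OF t(1) permutes_compose[OF t(2,1)]]])
        (simp_all add: Transposition.transpose_def)
    then show ?thesis by blast
  qed
qed
lemma outer_invariant_image_mult:
  assumes pb: "(p, b) \<in> outer_invariant ` auto W_D4" and qc: "(q, c) \<in> outer_invariant ` auto W_D4"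
  shows "(p \<circ> q, (b + c) mod 2) \<in> outer_invariant ` auto W_D4"
proof -
  obtain a1 where a1: "a1 \<in> auto W_D4" "(p, b) = outer_invariant a1" using pb by blast
  obtain a2 where a2: "a2 \<in> auto W_D4" "(q, c) = outer_invariant a2" using qc by blast
  have "compose (carrier W_D4) a1 a2 \<in> auto W_D4"
    using monoid.m_closed[OF group.is_monoid[OF W.AutoGroup]] a1(1) a2(1)
    by (simp add: AutoGroup_carrier AutoGroup_mult)
  moreover have "(p \<circ> q, (b + c) mod 2) = outer_invariant (compose (carrier W_D4) a1 a2)"
    using outer_invariant_compose[OF a1(1) a2(1)] a1(2)[symmetric] a2(2)[symmetric] by simp
  ultimately show ?thesis by blast
qed

lemma outer_invariant_surj: "outer_invariant ` carrier (AutoGroup W_D4) = carrier S3_x_Z2"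
proof
  show "outer_invariant ` carrier (AutoGroup W_D4) \<subseteq> carrier S3_x_Z2"
    using hom_in_carrier[OF outer_invariant_hom] by blast
next
  let ?Im = "outer_invariant ` auto W_D4"
  note mult = outer_invariant_image_mult
  have t12: "(t12, 0) \<in> ?Im" using refl_half_auto outer_invariant_refl_half[symmetric] by blast
  have t23: "(t23, 0) \<in> ?Im" using refl_e4_auto outer_invariant_refl_e4[symmetric] by blast
  have twist: "(id, 1) \<in> ?Im" using det_twist_auto outer_invariant_det_twist[symmetric] by blast
  have even: "(p, 0) \<in> ?Im" if "p permutes {1..3}" for p
  proof -
    have "(id, 0) \<in> ?Im" using mult[OF twist twist] by simp
    moreover have "(t12 \<circ> t23, 0) \<in> ?Im" "(t23 \<circ> t12, 0) \<in> ?Im" "(t12 \<circ> t23 \<circ> t12, 0) \<in> ?Im"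
      using mult[OF t12 t23] mult[OF t23 t12] mult[OF mult[OF t12 t23] t12] by simp_all
    moreover have "p = id \<or> p = t12 \<or> p = t23 \<or> p = t12 \<circ> t23 \<or> p = t23 \<circ> t12 \<or> p = t12 \<circ> t23 \<circ> t12"
      using permutes_3_cases[OF that] by (simp only: insert_iff empty_iff simp_thms)
    ultimately show ?thesis using t12 t23 by (elim disjE) simp_all
  qed
  show "carrier S3_x_Z2 \<subseteq> outer_invariant ` carrier (AutoGroup W_D4)"
  proof
    fix x assume "x \<in> carrier S3_x_Z2"
    moreover have "carrier (integer_mod_group 2) = {0, 1}"
      by (auto simp: carrier_integer_mod_group)
    ultimately obtain p b where x: "x = (p, b)" "p permutes {1..3}" "b = 0 \<or> b = 1"
      by (auto simp: sym_group_carrier)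
    have "(p, 0) \<in> ?Im" by (rule even[OF x(2)])
    moreover from mult[OF this twist] have "(p, 1) \<in> ?Im" by simp
    ultimately have "(p, b) \<in> ?Im" using x(3) by blast
    then show "x \<in> outer_invariant ` carrier (AutoGroup W_D4)"
      by (simp add: x(1) AutoGroup_carrier)
  qed
qed

theorem corollary5p2:
  shows "AutoGroup W_D4 Mod Inn W_D4 \<cong> DirProd (sym_group 3) (integer_mod_group 2)"
proof -
  have "group_hom (AutoGroup W_D4) S3_x_Z2 outer_invariant"
    by (simp add: group_hom_def group_hom_axioms_def outer_invariant_hom W.AutoGroup
        DirProd_group sym_group_is_group)
  then have "AutoGroup W_D4 Mod kernel (AutoGroup W_D4) S3_x_Z2 outer_invariant \<cong> S3_x_Z2"
    using group_hom.FactGroup_iso outer_invariant_surj by blast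
  then show ?thesis by (simp add: kernel_outer_invariant)
qed

end
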